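(* Let $\alpha>0$, $d\ge2$, and let $\Omega\subset\mathbb{R}^d$ be open and convex. Let $\mathbf{D}=\mathbf{D}^{(\alpha)}$ be the $L^{(\alpha)}$-divergence of an $\alpha$-exponentially concave function $\varphi$ on $\Omega$ satisfying conditions (A) of the context, respectively let $\mathbf{D}=\mathbf{D}^{(-\alpha)}$ be the $L^{(-\alpha)}$-divergence of an $\alpha$-exponentially convex function $\varphi$ on $\Omega$ satisfying conditions (B) of the context. Let $(g,\nabla,\nabla^* )$ be the dualistic structure induced by $\mathbf{D}$ on the manifold $\Omega$. Then: (i) (dual projective flatness) both $\nabla$ and $\nabla^*$ are projectively flat; (ii) both $\nabla$ and $\nabla^*$ have constant sectional curvature $-\alpha$ with respect to $g$ if $\mathbf{D}=\mathbf{D}^{(\alpha)}$, respectively $+\alpha$ if $\mathbf{D}=\mathbf{D}^{(-\alpha)}$; (iii) (generalized Pythagorean theorem) for all $p,q,r\in\Omega$ such that the dual geodesic from $q$ to $p$ exists (i.e. the line segment between the dual coordinates $\eta_q$ and $\eta_p$ lies in $\Omega'=D^{(\alpha)}\varphi(\Omega)$), the relation $$\mathbf{D}[q:p]+\mathbf{D}[r:q]=\mathbf{D}[r:p]$$ holds if and only if the primal geodesic from $q$ to $r$ and the dual geodesic from $q$ to $p$ meet $g$-orthogonally at $q$.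
   Context: $D$, $D^2$ are the Euclidean gradient and Hessian. $\varphi$ is $\alpha$-exponentially concave (convex) if $e^{\alpha\varphi}$ is concave (convex). Conditions (A): $\varphi$ is smooth on $\Omega$, $-D^2\varphi-\alpha(D\varphi)(D\varphi)^\top$ is strictly positive definite on $\Omega$, and $1-\alpha D\varphi(\xi)\cdot\xi>0$ for all $\xi\in\Omega$. Conditions (B): $\varphi$ is smooth on $\Omega$, $D^2\varphi+\alpha(D\varphi)(D\varphi)^\top$ is strictly positive definite on $\Omega$, $0\in\Omega$, and $1+\alpha D\varphi(\xi')\cdot(\xi-\xi')>0$ for all $\xi,\xi'\in\Omega$. $\mathbf{D}^{(\alpha)}[\xi:\xi']=\frac1\alpha\log(1+\alpha D\varphi(\xi')\cdot(\xi-\xi'))-(\varphi(\xi)-\varphi(\xi'))$ and $\mathbf{D}^{(-\alpha)}[\xi:\xi']=(\varphi(\xi)-\varphi(\xi'))-\frac1\alpha\log(1+\alpha D\varphi(\xi')\cdot(\xi-\xi'))$. The dual coordinate system is $\eta=D^{(\alpha)}\varphi(\xi)=\frac{D\varphi(\xi)}{1-\alpha D\varphi(\xi)\cdot\xi}$ (a diffeomorphism from $\Omega$ onto the open set $\Omega'$); $\eta_p$ denotes the dual coordinate of the point $p$. Dualistic structure induced by a divergence: the Riemannian metric $g=\langle\cdot,\cdot\rangle$ and torsion-free affine connections $\nabla$ (primal), $\nabla^*$ (dual) given in the coordinates $\xi$ by $g_{ij}=-\partial_{\xi^i}\partial_{\xi'^j}\mathbf{D}[\xi:\xi']|_{\xi'=\xi}$,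 $\langle\nabla_{\partial_i}\partial_j,\partial_k\rangle=-\partial_{\xi^i}\partial_{\xi^j}\partial_{\xi'^k}\mathbf{D}[\xi:\xi']|_{\xi'=\xi}$, $\langle\nabla^*_{\partial_i}\partial_j,\partial_k\rangle=-\partial_{\xi'^i}\partial_{\xi'^j}\partial_{\xi^k}\mathbf{D}[\xi:\xi']|_{\xi'=\xi}$. Primal (dual) geodesics are the geodesics of $\nabla$ ($\nabla^*$). A torsion-free connection $\nabla$ is projectively flat if there are a flat torsion-free connection $\widetilde\nabla$ (vanishing curvature tensor) and a $1$-form $\tau$ with $\nabla_XY=\widetilde\nabla_XY+\tau(X)Y+\tau(Y)X$ for all vector fields $X,Y$. A torsion-free connection with curvature tensor $R(X,Y)Z=\nabla_X\nabla_YZ-\nabla_Y\nabla_XZ-\nabla_{[X,Y]}Z$ has constant sectional curvature $k$ with respect to $g$ if $R(X,Y)Z=k(\langle Y,Z\rangle X-\langle X,Z\rangle Y)$ for all vector fields $X,Y,Z$. *)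

theory Defs
  imports "HOL-Analysis.Analysis"
begin

definition partial :: "'n::finite \<Rightarrow> (real^'n \<Rightarrow> real) \<Rightarrow> real^'n \<Rightarrow> real" where
  "partial i f x = frechet_derivative f (at x) (axis i 1)"

definition grad :: "(real^'n::finite \<Rightarrow> real) \<Rightarrow> real^'n \<Rightarrow> real^'n" where
  "grad f x = (\<chi> i. partial i f x)"

definition hessian :: "(real^'n::finite \<Rightarrow> real) \<Rightarrow> real^'n \<Rightarrow> real^'n^'n" where
  "hessian f x = (\<chi> i j. partial i (partial j f) x)"

definition outer :: "real^'n::finite \<Rightarrow> real^'n \<Rightarrow> real^'n^'n" where
  "outer u v = (\<chi> i j. u $ i * v $ j)"

definition pos_definite :: "real^'n^'n::finite \<Rightarrow> bool" where
  "pos_definite A \<longleftrightarrow> transpose A = A \<and> (\<forall>v. v \<noteq> 0 \<longrightarrow> 0 < v \<bullet> (A *v v))"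

text \<open>Smoothness is meant on open sets \<open>S\<close>; values of \<open>f\<close> outside \<open>S\<close> play no role there.\<close>

primrec C_k_on :: "nat \<Rightarrow> (real^'n::finite) set \<Rightarrow> (real^'n \<Rightarrow> real) \<Rightarrow> bool" where
  "C_k_on 0 S f \<longleftrightarrow> continuous_on S f"
| "C_k_on (Suc k) S f \<longleftrightarrow> (\<forall>x\<in>S. f differentiable (at x)) \<and> (\<forall>i. C_k_on k S (partial i f))"

definition smooth_fun :: "(real^'n::finite) set \<Rightarrow> (real^'n \<Rightarrow> real) \<Rightarrow> bool" where
  "smooth_fun S f \<longleftrightarrow> (\<forall>k. C_k_on k S f)"

text \<open>Vector fields, and also 1-forms, are given by their components in the global
  coordinates of \<open>real^'n\<close>; the 1-form \<open>\<tau>\<close> sends \<open>X\<close> to \<open>\<tau> \<bullet> X\<close> (Euclidean inner product).\<close>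

definition smooth_field :: "(real^'n::finite) set \<Rightarrow> (real^'n \<Rightarrow> real^'n) \<Rightarrow> bool" where
  "smooth_field S X \<longleftrightarrow> (\<forall>i. smooth_fun S (\<lambda>x. X x $ i))"

text \<open>In the global chart \<open>\<xi>\<close> a connection is the same thing as the vector fields
  \<open>\<Gamma> x i j = (\<nabla>\<^bsub>\<partial>\<^sub>i\<^esub> \<partial>\<^sub>j) x\<close>, whose components are the Christoffel symbols.\<close>

type_synonym 'n connection = "real^'n \<Rightarrow> 'n \<Rightarrow> 'n \<Rightarrow> real^'n"

definition smooth_connection :: "(real^'n::finite) set \<Rightarrow> 'n connection \<Rightarrow> bool" where
  "smooth_connection \<Omega> \<Gamma> \<longleftrightarrow> (\<forall>i j. smooth_field \<Omega> (\<lambda>x. \<Gamma> x i j))"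

definition christoffel :: "'n::finite connection \<Rightarrow> real^'n \<Rightarrow> real^'n \<Rightarrow> real^'n \<Rightarrow> real^'n" where
  "christoffel \<Gamma> x u v = (\<Sum>i\<in>UNIV. \<Sum>j\<in>UNIV. (u $ i * v $ j) *\<^sub>R \<Gamma> x i j)"

definition cov_deriv ::
  "'n::finite connection \<Rightarrow> (real^'n \<Rightarrow> real^'n) \<Rightarrow> (real^'n \<Rightarrow> real^'n) \<Rightarrow> real^'n \<Rightarrow> real^'n" where
  "cov_deriv \<Gamma> X Y x = frechet_derivative Y (at x) (X x) + christoffel \<Gamma> x (X x) (Y x)"

definition lie_bracket ::
  "(real^'n::finite \<Rightarrow> real^'n) \<Rightarrow> (real^'n \<Rightarrow> real^'n) \<Rightarrow> real^'n \<Rightarrow> real^'n" where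
  "lie_bracket X Y x = frechet_derivative Y (at x) (X x) - frechet_derivative X (at x) (Y x)"

definition curvature ::
  "'n::finite connection \<Rightarrow> (real^'n \<Rightarrow> real^'n) \<Rightarrow> (real^'n \<Rightarrow> real^'n) \<Rightarrow>
    (real^'n \<Rightarrow> real^'n) \<Rightarrow> real^'n \<Rightarrow> real^'n" where
  "curvature \<Gamma> X Y Z x =
    cov_deriv \<Gamma> X (cov_deriv \<Gamma> Y Z) x - cov_deriv \<Gamma> Y (cov_deriv \<Gamma> X Z) x
      - cov_deriv \<Gamma> (lie_bracket X Y) Z x"

definition torsion_free_connection :: "(real^'n::finite) set \<Rightarrow> 'n connection \<Rightarrow> bool" where
  "torsion_free_connection \<Omega> \<Gamma> \<longleftrightarrow> smooth_connection \<Omega> \<Gamma> \<and>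
    (\<forall>X Y. smooth_field \<Omega> X \<longrightarrow> smooth_field \<Omega> Y \<longrightarrow>
      (\<forall>x\<in>\<Omega>. cov_deriv \<Gamma> X Y x - cov_deriv \<Gamma> Y X x = lie_bracket X Y x))"

definition flat_connection :: "(real^'n::finite) set \<Rightarrow> 'n connection \<Rightarrow> bool" where
  "flat_connection \<Omega> \<Gamma> \<longleftrightarrow>
    (\<forall>X Y Z. smooth_field \<Omega> X \<longrightarrow> smooth_field \<Omega> Y \<longrightarrow> smooth_field \<Omega> Z \<longrightarrow>
      (\<forall>x\<in>\<Omega>. curvature \<Gamma> X Y Z x = 0))"

definition projectively_flat :: "(real^'n::finite) set \<Rightarrow> 'n connection \<Rightarrow> bool" where
  "projectively_flat \<Omega> \<Gamma> \<longleftrightarrow> torsion_free_connection \<Omega> \<Gamma> \<and>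
    (\<exists>\<Gamma>' \<tau>. torsion_free_connection \<Omega> \<Gamma>' \<and> flat_connection \<Omega> \<Gamma>' \<and> smooth_field \<Omega> \<tau> \<and>
      (\<forall>X Y. smooth_field \<Omega> X \<longrightarrow> smooth_field \<Omega> Y \<longrightarrow>
        (\<forall>x\<in>\<Omega>. cov_deriv \<Gamma> X Y x =
          cov_deriv \<Gamma>' X Y x + (\<tau> x \<bullet> X x) *\<^sub>R Y x + (\<tau> x \<bullet> Y x) *\<^sub>R X x)))"

text \<open>The metric is given by its Gram matrices \<open>G x\<close> in the coordinate frame.\<close>

definition metric_inner :: "(real^'n \<Rightarrow> real^'n^'n) \<Rightarrow> real^'n::finite \<Rightarrow> real^'n \<Rightarrow> real^'n \<Rightarrow> real" where
  "metric_inner G x u v = u \<bullet> (G x *v v)"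

definition constant_sectional_curvature ::
  "(real^'n::finite) set \<Rightarrow> (real^'n \<Rightarrow> real^'n^'n) \<Rightarrow> 'n connection \<Rightarrow> real \<Rightarrow> bool" where
  "constant_sectional_curvature \<Omega> G \<Gamma> k \<longleftrightarrow> torsion_free_connection \<Omega> \<Gamma> \<and>
    (\<forall>X Y Z. smooth_field \<Omega> X \<longrightarrow> smooth_field \<Omega> Y \<longrightarrow> smooth_field \<Omega> Z \<longrightarrow>
      (\<forall>x\<in>\<Omega>. curvature \<Gamma> X Y Z x =
        k *\<^sub>R (metric_inner G x (Y x) (Z x) *\<^sub>R X x - metric_inner G x (X x) (Z x) *\<^sub>R Y x)))"

definition velocity :: "(real \<Rightarrow> real^'n::finite) \<Rightarrow> real \<Rightarrow> real^'n" where
  "velocity c t = vector_derivative c (at t within {0..1})"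

text \<open>Affinely parametrised geodesics on the unit interval; derivatives at the end points are
  one-sided, and constant curves are included.\<close>

definition geodesic_from_to ::
  "(real^'n::finite) set \<Rightarrow> 'n connection \<Rightarrow> real^'n \<Rightarrow> real^'n \<Rightarrow> (real \<Rightarrow> real^'n) \<Rightarrow> bool" where
  "geodesic_from_to \<Omega> \<Gamma> a b c \<longleftrightarrow> c 0 = a \<and> c 1 = b \<and> c ` {0..1} \<subseteq> \<Omega> \<and>
    (\<forall>t\<in>{0..1}. c differentiable (at t within {0..1}) \<and>
      velocity c differentiable (at t within {0..1}) \<and>
      velocity (velocity c) t + christoffel \<Gamma> (c t) (velocity c t) (velocity c t) = 0)"

text \<open>A divergence \<open>D[\<xi> : \<xi>']\<close> is written \<open>D \<xi> \<xi>'\<close>. The operators \<open>partial_fst\<close> and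
  \<open>partial_snd\<close> differentiate with respect to \<open>\<xi>\<close> and \<open>\<xi>'\<close>.\<close>

type_synonym 'n divergence = "real^'n \<Rightarrow> real^'n \<Rightarrow> real"

definition partial_fst :: "'n::finite \<Rightarrow> 'n divergence \<Rightarrow> 'n divergence" where
  "partial_fst i D = (\<lambda>x y. partial i (\<lambda>z. D z y) x)"

definition partial_snd :: "'n::finite \<Rightarrow> 'n divergence \<Rightarrow> 'n divergence" where
  "partial_snd i D = (\<lambda>x y. partial i (\<lambda>z. D x z) y)"

definition div_metric :: "'n::finite divergence \<Rightarrow> real^'n \<Rightarrow> real^'n^'n" where
  "div_metric D x = (\<chi> i j. - partial_fst i (partial_snd j D) x x)"

text \<open>The inner products with the coordinate fields determine the following two vectors as soon
  as \<open>div_metric D x\<close> is nondegenerate.\<close>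

definition primal_connection :: "'n::finite divergence \<Rightarrow> 'n connection" where
  "primal_connection D x i j = (THE v. \<forall>k.
    metric_inner (div_metric D) x v (axis k 1) =
      - partial_fst i (partial_fst j (partial_snd k D)) x x)"

definition dual_connection :: "'n::finite divergence \<Rightarrow> 'n connection" where
  "dual_connection D x i j = (THE v. \<forall>k.
    metric_inner (div_metric D) x v (axis k 1) =
      - partial_snd i (partial_snd j (partial_fst k D)) x x)"

definition exp_concave_on :: "real \<Rightarrow> (real^'n::finite) set \<Rightarrow> (real^'n \<Rightarrow> real) \<Rightarrow> bool" where
  "exp_concave_on \<alpha> \<Omega> \<phi> \<longleftrightarrow> concave_on \<Omega> (\<lambda>x. exp (\<alpha> * \<phi> x))"

definition exp_convex_on :: "real \<Rightarrow> (real^'n::finite) set \<Rightarrow> (real^'n \<Rightarrow> real) \<Rightarrow> bool" where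
  "exp_convex_on \<alpha> \<Omega> \<phi> \<longleftrightarrow> convex_on \<Omega> (\<lambda>x. exp (\<alpha> * \<phi> x))"

definition conditions_A :: "real \<Rightarrow> (real^'n::finite) set \<Rightarrow> (real^'n \<Rightarrow> real) \<Rightarrow> bool" where
  "conditions_A \<alpha> \<Omega> \<phi> \<longleftrightarrow> smooth_fun \<Omega> \<phi> \<and>
    (\<forall>\<xi>\<in>\<Omega>. pos_definite (- hessian \<phi> \<xi> - \<alpha> *\<^sub>R outer (grad \<phi> \<xi>) (grad \<phi> \<xi>))) \<and>
    (\<forall>\<xi>\<in>\<Omega>. 0 < 1 - \<alpha> * (grad \<phi> \<xi> \<bullet> \<xi>))"

definition conditions_B :: "real \<Rightarrow> (real^'n::finite) set \<Rightarrow> (real^'n \<Rightarrow> real) \<Rightarrow> bool" where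
  "conditions_B \<alpha> \<Omega> \<phi> \<longleftrightarrow> smooth_fun \<Omega> \<phi> \<and>
    (\<forall>\<xi>\<in>\<Omega>. pos_definite (hessian \<phi> \<xi> + \<alpha> *\<^sub>R outer (grad \<phi> \<xi>) (grad \<phi> \<xi>))) \<and>
    0 \<in> \<Omega> \<and>
    (\<forall>\<xi>\<in>\<Omega>. \<forall>\<xi>'\<in>\<Omega>. 0 < 1 + \<alpha> * (grad \<phi> \<xi>' \<bullet> (\<xi> - \<xi>')))"

definition L_plus_divergence :: "real \<Rightarrow> (real^'n::finite \<Rightarrow> real) \<Rightarrow> 'n divergence" where
  "L_plus_divergence \<alpha> \<phi> \<xi> \<xi>' =
    1 / \<alpha> * ln (1 + \<alpha> * (grad \<phi> \<xi>' \<bullet> (\<xi> - \<xi>'))) - (\<phi> \<xi> - \<phi> \<xi>')"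

definition L_minus_divergence :: "real \<Rightarrow> (real^'n::finite \<Rightarrow> real) \<Rightarrow> 'n divergence" where
  "L_minus_divergence \<alpha> \<phi> \<xi> \<xi>' =
    (\<phi> \<xi> - \<phi> \<xi>') - 1 / \<alpha> * ln (1 + \<alpha> * (grad \<phi> \<xi>' \<bullet> (\<xi> - \<xi>')))"

definition dual_coord :: "real \<Rightarrow> (real^'n::finite \<Rightarrow> real) \<Rightarrow> real^'n \<Rightarrow> real^'n" where
  "dual_coord \<alpha> \<phi> \<xi> = (1 / (1 - \<alpha> * (grad \<phi> \<xi> \<bullet> \<xi>))) *\<^sub>R grad \<phi> \<xi>"

end

theory Submission
  imports Defs
begin

text \<open>
  Both connections are induced by centroaffine immersions of \<open>\<Omega>\<close> into \<open>real^'n \<times> real\<close>: every component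
  \<open>f\<close> of the immersion satisfies the Gauss equation \<open>\<partial>\<^sub>i \<partial>\<^sub>j f = df (\<Gamma>\<^sub>i\<^sub>j) + h\<^sub>i\<^sub>j f\<close> with the same
  \<open>h = - \<alpha> (D\<^sup>2\<phi> + \<alpha> D\<phi> D\<phi>\<^sup>T)\<close>, which is \<open>- \<kappa>\<close> times the metric. The primal immersion is
  \<open>exp (- \<alpha> \<phi>) (\<xi>, 1)\<close> and the dual one is \<open>exp (\<alpha> \<phi>) (D\<phi>, 1 - \<alpha> D\<phi> \<bullet> \<xi>)\<close>.
  The flatness of the ambient space yields \<open>R(X,Y)Z = h(X,Z) Y - h(Y,Z) X\<close>, and central projection to
  an affine hyperplane, that is to the coordinates \<open>\<xi>\<close> and \<open>\<eta>\<close>, changes the connection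
  projectively into a flat one. Geodesics lie in planes through the origin, so that they are
  reparametrised segments in \<open>\<xi>\<close> and \<open>\<eta>\<close>; after exponentiation the Pythagorean relation is then a
  polynomial identity in \<open>\<xi>\<close> and \<open>\<eta>\<close>.
\<close>

section \<open>Smooth functions\<close>

text \<open>The two immersions are dual under the pairing of \<open>(x, 1)\<close> with
  \<open>(u, w)\<close> that gives \<open>\<alpha> * (u \<bullet> x) + w\<close>: pairing the primal
  one at \<open>x\<close> with the dual one at \<open>y\<close> yields
  \<open>N x y * exp (- \<alpha> * (\<phi> x - \<phi> y))\<close>, which is
  \<open>exp (s * \<alpha> * D x y)\<close>. The divergence is thus the logarithm of a bilinear
  expression. The sign \<open>s\<close>, 1 in the concave and -1 in the convex case, enters the
  metric \<open>- s\<close> times \<open>M\<close> but cancels from both connections. The dual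
  Christoffel symbols involve the inverse of \<open>M\<close>. They are never computed: the
  differential of the dual immersion contains \<open>M\<close> as a factor, so that the linear
  equation \<open>M x *v dual_connection D x i j = b x i j\<close> suffices. Geodesics need no
  general theory of differential equations. Along a geodesic all components of the immersion solve
  one linear equation of second order, so their Wronskians with the last component are constant.
  This forces segments in the chart, and it also dictates the speed at which a segment must be
  traversed to become a geodesic.\<close>

lemma partial_eqI:
  assumes "(f has_derivative f') (at x)"
  shows "partial i f x = f' (axis i 1)"
  using frechet_derivative_at[OF assms] by (simp add: partial_def)

lemma frechet_derivative_eq_grad:
  assumes "f differentiable (at x)"
  shows "frechet_derivative f (at x) v = grad f x \<bullet> v"
proof -
  have lin: "linear (frechet_derivative f (at x))"
    using assms by (rule linear_frechet_derivative)
  have "frechet_derivative f (at x) v = frechet_derivative f (at x) (\<Sum>i\<in>UNIV. v $ i *\<^sub>R axis i 1)"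
    by (simp only: basis_expansion scalar_mult_eq_scaleR[symmetric])
  also have "\<dots> = (\<Sum>i\<in>UNIV. v $ i * frechet_derivative f (at x) (axis i 1))"
    using lin by (simp add: linear_sum linear_scale)
  also have "\<dots> = grad f x \<bullet> v"
    by (simp add: inner_vec_def grad_def partial_def mult.commute)
  finally show ?thesis .
qed

lemma has_derivative_grad:
  assumes "f differentiable (at x)"
  shows "(f has_derivative (\<lambda>v. grad f x \<bullet> v)) (at x)"
  using assms frechet_derivative_works[of f "at x"] frechet_derivative_eq_grad[OF assms]
  by (metis (no_types, lifting) ext)

lemma frechet_derivative_vec_nth:
  fixes F :: "real^'m::finite \<Rightarrow> real^'n::finite"
  assumes "\<And>k. (\<lambda>y. F y $ k) differentiable (at x)"
  shows "frechet_derivative F (at x) v $ k = grad (\<lambda>y. F y $ k) x \<bullet> v"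
proof -
  have "(F has_derivative (\<lambda>v. \<chi> k. grad (\<lambda>y. F y $ k) x \<bullet> v)) (at x)"
    unfolding has_derivative_componentwise_within[of F]
    by (auto simp: Basis_vec_def inner_axis intro!: has_derivative_grad assms)
  from frechet_derivative_at[OF this] show ?thesis
    by (metis vec_lambda_beta)
qed

lemma grad_inner_axis [simp]: "grad f x \<bullet> axis i 1 = partial i f x" "grad f x $ i = partial i f x"
  by (simp_all add: inner_axis grad_def)

text \<open>\<open>frechet_derivative\<close> is a choice among derivatives, so it depends only on
  which maps are derivatives, and that is a local property. This transfers identities known only on
  an open set.\<close>

lemma partial_cong:
  assumes "open S" "x \<in> S" "\<And>y. y \<in> S \<Longrightarrow> f y = g y"
  shows "partial i f x = partial i g x"
proof -
  have "(f has_derivative F) (at x) \<longleftrightarrow> (g has_derivative F) (at x)" for F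
    using has_derivative_transform_within_open[of _ F x UNIV S] assms by metis
  then show ?thesis
    by (simp add: partial_def frechet_derivative_def)
qed

lemma differentiable_cong_open:
  assumes "open S" "x \<in> S" "\<And>y. y \<in> S \<Longrightarrow> f y = g y" "f differentiable (at x)"
  shows "g differentiable (at x)"
  using assms has_derivative_transform_within_open[of f _ x UNIV S g]
  unfolding differentiable_def by metis

lemma C_k_on_cong:
  assumes "open S" "\<And>y. y \<in> S \<Longrightarrow> f y = g y" "C_k_on k S f"
  shows "C_k_on k S g"
  using assms(2,3)
proof (induction k arbitrary: f g)
  case 0
  then show ?case by (simp cong: continuous_on_cong)
next
  case (Suc k)
  have "partial i f y = partial i g y" if "y \<in> S" for i y
    using partial_cong[OF assms(1) that] Suc.prems by metis
  moreover have "g differentiable (at x)" if "x \<in> S" for x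
    using differentiable_cong_open[OF assms(1) that Suc.prems(1)] Suc.prems(2) that by auto
  ultimately show ?case
    using Suc by (metis C_k_on.simps(2))
qed

lemma C_k_on_SucD: "C_k_on (Suc k) S f \<Longrightarrow> C_k_on k S f"
proof (induction k arbitrary: f)
  case 0
  then show ?case
    by (metis C_k_on.simps differentiable_at_imp_differentiable_on differentiable_imp_continuous_on)
next
  case (Suc k)
  then show ?case by (metis C_k_on.simps(2))
qed

lemma smooth_funD:
  assumes "smooth_fun S f"
  shows "smooth_fun S (partial i f)" "x \<in> S \<Longrightarrow> f differentiable (at x)" "continuous_on S f"
proof -
  have *: "C_k_on k S f" for k
    using assms by (simp add: smooth_fun_def)
  show "smooth_fun S (partial i f)"
    using *[of "Suc _"] by (simp add: smooth_fun_def)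
  show "x \<in> S \<Longrightarrow> f differentiable (at x)" using *[of 1] by simp
  show "continuous_on S f" using *[of 0] by simp
qed

lemma smooth_fun_cong:
  "open S \<Longrightarrow> smooth_fun S f \<Longrightarrow> (\<And>y. y \<in> S \<Longrightarrow> f y = g y) \<Longrightarrow> smooth_fun S g"
  using C_k_on_cong[of S f g] by (auto simp: smooth_fun_def)

lemma partial_const [simp]: "partial i (\<lambda>x. c) = (\<lambda>x. 0)"
  by (simp add: partial_def fun_eq_iff)

lemma partial_component [simp]: "partial i (\<lambda>x. x $ j) = (\<lambda>x. if i = j then 1 else 0)"
proof
  fix x :: "real^'a"
  have "((\<lambda>x. x $ j) has_derivative (\<lambda>x. x $ j)) (at x)"
    by (simp add: bounded_linear.has_derivative[OF bounded_linear_vec_nth] has_derivative_ident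
      bounded_linear_imp_has_derivative bounded_linear_vec_nth)
  from partial_eqI[OF this] show "partial i (\<lambda>x. x $ j) x = (if i = j then 1 else 0)"
    by (simp add: axis_def)
qed

context
  fixes f g :: "real^'n::finite \<Rightarrow> real" and x :: "real^'n"
  assumes f: "f differentiable (at x)" and g: "g differentiable (at x)"
begin

lemma partial_add: "partial i (\<lambda>y. f y + g y) x = partial i f x + partial i g x"
  by (subst partial_eqI[OF has_derivative_add[OF has_derivative_grad[OF f] has_derivative_grad[OF g]]])
     simp

lemma partial_diff: "partial i (\<lambda>y. f y - g y) x = partial i f x - partial i g x"
  by (subst partial_eqI[OF has_derivative_diff[OF has_derivative_grad[OF f] has_derivative_grad[OF g]]])
     simp

lemma partial_mult: "partial i (\<lambda>y. f y * g y) x = partial i f x * g x + f x * partial i g x"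
  by (subst partial_eqI[OF has_derivative_mult[OF has_derivative_grad[OF f] has_derivative_grad[OF g]]])
     simp

end

lemma partial_real_compose:
  assumes f: "f differentiable (at x)" and "(h has_real_derivative h') (at (f x))"
  shows "partial i (\<lambda>y. h (f y)) x = h' * partial i f x"
proof -
  have "((\<lambda>y. h (f y)) has_derivative (\<lambda>v. h' * (grad f x \<bullet> v))) (at x)"
    using has_derivative_compose[OF has_derivative_grad[OF f], of h "(*) h'"] assms
    by (simp add: has_field_derivative_def)
  from partial_eqI[OF this] show ?thesis by simp
qed

lemma differentiable_real_compose:
  fixes f :: "'a::real_normed_vector \<Rightarrow> real"
  assumes "f differentiable (at x)" "(h has_real_derivative h') (at (f x))"
  shows "(\<lambda>y. h (f y)) differentiable (at x)"
  using assms has_derivative_compose[of f _ x UNIV h "(*) h'"]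
  unfolding differentiable_def has_field_derivative_def by blast

lemma partial_sum:
  assumes "\<And>j. j \<in> A \<Longrightarrow> f j differentiable (at x)"
  shows "partial i (\<lambda>y. \<Sum>j\<in>A. f j y) x = (\<Sum>j\<in>A. partial i (f j) x)"
  by (subst partial_eqI[OF has_derivative_sum[OF has_derivative_grad[OF assms]]]) auto

section \<open>Closure properties of smooth functions\<close>

lemma C_k_on_add:
  assumes "open S" "C_k_on k S f" "C_k_on k S g"
  shows "C_k_on k S (\<lambda>x. f x + g x)"
  using assms(2,3)
proof (induction k arbitrary: f g)
  case 0
  then show ?case by (auto intro: continuous_intros)
next
  case (Suc k)
  have "C_k_on k S (partial i (\<lambda>x. f x + g x))" for i
    by (rule C_k_on_cong[OF assms(1) _ Suc.IH[of "partial i f" "partial i g"]])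
       (use Suc.prems in \<open>auto simp: partial_add\<close>)
  then show ?case using Suc.prems by auto
qed

lemma C_k_on_mult:
  assumes "open S" "C_k_on k S f" "C_k_on k S g"
  shows "C_k_on k S (\<lambda>x. f x * g x)"
  using assms(2,3)
proof (induction k arbitrary: f g)
  case 0
  then show ?case by (auto intro: continuous_intros)
next
  case (Suc k)
  have "C_k_on k S (\<lambda>x. partial i f x * g x + f x * partial i g x)" for i
    using Suc.prems C_k_on_SucD[OF Suc.prems(1)] C_k_on_SucD[OF Suc.prems(2)]
    by (intro C_k_on_add Suc.IH assms(1)) auto
  then have "C_k_on k S (partial i (\<lambda>x. f x * g x))" for i
    by (rule C_k_on_cong[OF assms(1), rotated])
       (use Suc.prems in \<open>auto simp: partial_mult\<close>)
  then show ?case using Suc.prems by auto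
qed

lemma C_k_on_const: "C_k_on k S (\<lambda>x. c)"
  by (induction k arbitrary: c) auto

lemma smooth_fun_const [intro]: "smooth_fun S (\<lambda>x. c)"
  by (simp add: smooth_fun_def C_k_on_const)

lemma smooth_fun_add:
  "open S \<Longrightarrow> smooth_fun S f \<Longrightarrow> smooth_fun S g \<Longrightarrow> smooth_fun S (\<lambda>x. f x + g x)"
  by (simp add: smooth_fun_def C_k_on_add)

lemma smooth_fun_mult:
  "open S \<Longrightarrow> smooth_fun S f \<Longrightarrow> smooth_fun S g \<Longrightarrow> smooth_fun S (\<lambda>x. f x * g x)"
  by (simp add: smooth_fun_def C_k_on_mult)

lemma smooth_fun_cmult: "open S \<Longrightarrow> smooth_fun S f \<Longrightarrow> smooth_fun S (\<lambda>x. c * f x)"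
  by (rule smooth_fun_mult) auto

lemma smooth_fun_uminus: "open S \<Longrightarrow> smooth_fun S f \<Longrightarrow> smooth_fun S (\<lambda>x. - f x)"
  using smooth_fun_cmult[of S f "-1"] by simp

lemma smooth_fun_diff:
  "open S \<Longrightarrow> smooth_fun S f \<Longrightarrow> smooth_fun S g \<Longrightarrow> smooth_fun S (\<lambda>x. f x - g x)"
  using smooth_fun_add[of S f "\<lambda>x. - g x"] by (simp add: smooth_fun_uminus)

lemma smooth_fun_sum:
  assumes "open S" "\<And>j. j \<in> A \<Longrightarrow> smooth_fun S (f j)"
  shows "smooth_fun S (\<lambda>x. \<Sum>j\<in>A. f j x)"
  using assms(2) by (induction A rule: infinite_finite_induct) (auto intro!: smooth_fun_add assms(1))

lemma smooth_fun_prod: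
  assumes "open S" "\<And>j. j \<in> A \<Longrightarrow> smooth_fun S (f j)"
  shows "smooth_fun S (\<lambda>x. \<Prod>j\<in>A. f j x)"
  using assms(2) by (induction A rule: infinite_finite_induct) (auto intro!: smooth_fun_mult assms(1))

lemma smooth_fun_component: "smooth_fun S (\<lambda>x. x $ j)"
proof -
  have "C_k_on k S (\<lambda>x. x $ j)" for k
    by (cases k) (auto simp: C_k_on_const intro!: continuous_intros bounded_linear_imp_differentiable
      bounded_linear_vec_nth)
  then show ?thesis by (simp add: smooth_fun_def)
qed

text \<open>The derivative is a polynomial in the function itself and \<open>partial i f\<close>, so
  induction on the order closes with the hypothesis for the same \<open>f\<close>.
  \<open>smooth_fun_exp\<close> works likewise.\<close>

lemma smooth_fun_inverse:
  assumes "open S" "smooth_fun S f" "\<And>x. x \<in> S \<Longrightarrow> f x \<noteq> 0"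
  shows "smooth_fun S (\<lambda>x. inverse (f x))"
proof -
  have "C_k_on k S (\<lambda>x. inverse (f x))" for k
  proof (induction k)
    case 0
    then show ?case using smooth_funD[OF assms(2)] assms(3) by (auto intro!: continuous_intros)
  next
    case (Suc k)
    have D: "(inverse has_real_derivative (- (inverse (f x) * inverse (f x)))) (at (f x))"
      if "x \<in> S" for x
      using assms(3)[OF that] by (auto intro!: derivative_eq_intros)
    have "C_k_on k S (\<lambda>x. (-1) * (inverse (f x) * inverse (f x)) * partial i f x)" for i
      using smooth_funD(1)[OF assms(2), of i]
      by (intro C_k_on_mult C_k_on_const assms(1) Suc) (simp add: smooth_fun_def)
    note * = this
    have "C_k_on k S (partial i (\<lambda>x. inverse (f x)))" for i
      by (rule C_k_on_cong[OF assms(1) _ *[of i]])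
         (simp add: partial_real_compose[OF _ D] smooth_funD(2)[OF assms(2)])
    then show ?case
      by (auto intro: differentiable_real_compose[where h = inverse] D smooth_funD(2)[OF assms(2)])
  qed
  then show ?thesis by (simp add: smooth_fun_def)
qed

lemma smooth_fun_divide:
  "open S \<Longrightarrow> smooth_fun S f \<Longrightarrow> smooth_fun S g \<Longrightarrow> (\<And>x. x \<in> S \<Longrightarrow> g x \<noteq> 0) \<Longrightarrow>
    smooth_fun S (\<lambda>x. f x / g x)"
  by (simp add: divide_inverse smooth_fun_mult smooth_fun_inverse)

lemma smooth_fun_exp:
  assumes "open S" "smooth_fun S f"
  shows "smooth_fun S (\<lambda>x. exp (f x))"
proof -
  have "C_k_on k S (\<lambda>x. exp (f x))" for k
  proof (induction k)
    case 0
    then show ?case using smooth_funD[OF assms(2)] by (auto intro!: continuous_intros)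
  next
    case (Suc k)
    have "C_k_on k S (\<lambda>x. exp (f x) * partial i f x)" for i
      using smooth_funD(1)[OF assms(2), of i]
      by (intro C_k_on_mult assms(1) Suc) (simp add: smooth_fun_def)
    note * = this
    have "C_k_on k S (partial i (\<lambda>x. exp (f x)))" for i
      by (rule C_k_on_cong[OF assms(1) _ *[of i]])
         (simp add: partial_real_compose[OF _ DERIV_exp] smooth_funD(2)[OF assms(2)])
    then show ?case
      by (auto intro: differentiable_real_compose[where h = exp] DERIV_exp smooth_funD(2)[OF assms(2)])
  qed
  then show ?thesis by (simp add: smooth_fun_def)
qed

lemmas smooth_fun_intros = smooth_fun_const smooth_fun_add smooth_fun_mult smooth_fun_uminus
  smooth_fun_diff smooth_fun_sum smooth_fun_prod smooth_fun_component smooth_fun_exp smooth_funD(1)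

section \<open>Symmetry of second partial derivatives\<close>

lemma has_real_derivative_along_line:
  assumes "f differentiable (at (a + t *\<^sub>R v))"
  shows "((\<lambda>t. f (a + t *\<^sub>R v)) has_real_derivative (grad f (a + t *\<^sub>R v) \<bullet> v)) (at t)"
proof -
  have "((\<lambda>t. a + t *\<^sub>R v) has_derivative (\<lambda>s. s *\<^sub>R v)) (at t)"
    by (auto intro!: derivative_eq_intros)
  from has_derivative_compose[OF this has_derivative_grad[OF assms]]
  show ?thesis by (simp add: has_field_derivative_def mult.commute mult_commute_abs)
qed

text \<open>The second difference quotient equals a mixed partial derivative at a nearby point; by the
  symmetry of the difference this holds for both orders of differentiation.\<close>

lemma second_difference_mean_value:
  fixes f :: "real^'n::finite \<Rightarrow> real"
  assumes "smooth_fun S f" "0 < h"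
    and S: "\<And>s t. 0 \<le> s \<Longrightarrow> s \<le> h \<Longrightarrow> 0 \<le> t \<Longrightarrow> t \<le> h \<Longrightarrow> x + s *\<^sub>R axis i 1 + t *\<^sub>R axis j 1 \<in> S"
  shows "\<exists>s t. 0 \<le> s \<and> s \<le> h \<and> 0 \<le> t \<and> t \<le> h \<and>
    f (x + h *\<^sub>R axis i 1 + h *\<^sub>R axis j 1) - f (x + h *\<^sub>R axis i 1) - f (x + h *\<^sub>R axis j 1) + f x =
    h * h * partial j (partial i f) (x + s *\<^sub>R axis i 1 + t *\<^sub>R axis j 1)"
proof -
  let ?p = "\<lambda>s t. x + s *\<^sub>R axis i 1 + t *\<^sub>R axis j 1"
  have D1: "((\<lambda>s. f (?p s t)) has_real_derivative partial i f (?p s t)) (at s)"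
    if "0 \<le> s" "s \<le> h" "0 \<le> t" "t \<le> h" for s t
    using has_real_derivative_along_line[of f "x + t *\<^sub>R axis j 1" s "axis i 1"]
      smooth_funD(2)[OF assms(1) S[OF that]] by (simp add: algebra_simps)
  have D2: "((\<lambda>t. partial i f (?p s t)) has_real_derivative partial j (partial i f) (?p s t)) (at t)"
    if "0 \<le> s" "s \<le> h" "0 \<le> t" "t \<le> h" for s t
    using has_real_derivative_along_line[of "partial i f" "x + s *\<^sub>R axis i 1" t "axis j 1"]
      smooth_funD(2)[OF smooth_funD(1)[OF assms(1)] S[OF that]] by (simp add: algebra_simps)
  have "\<exists>s. 0 < s \<and> s < h \<and> (f (?p h h) - f (?p h 0)) - (f (?p 0 h) - f (?p 0 0)) =
     (h - 0) * (partial i f (?p s h) - partial i f (?p s 0))"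
    by (rule MVT2) (use assms(2) in \<open>auto intro!: DERIV_diff D1 simp del: scaleR_zero_left add_0_right\<close>)
  then obtain s where s: "0 < s" "s < h" "(f (?p h h) - f (?p h 0)) - (f (?p 0 h) - f (?p 0 0)) =
     (h - 0) * (partial i f (?p s h) - partial i f (?p s 0))" by blast
  have "\<exists>t. 0 < t \<and> t < h \<and> partial i f (?p s h) - partial i f (?p s 0) =
    (h - 0) * partial j (partial i f) (?p s t)"
    by (rule MVT2) (use assms(2) s in \<open>auto intro!: D2\<close>)
  then obtain t where "0 < t" "t < h" "partial i f (?p s h) - partial i f (?p s 0) =
    (h - 0) * partial j (partial i f) (?p s t)" by blast
  with s show ?thesis by (intro exI[of _ s] exI[of _ t]) (auto simp: algebra_simps)
qed

text \<open>One second difference is a value of either mixed derivative at some point of a small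
  square. By continuity each value is within half the supposed gap of the value at \<open>x\<close>,
  a contradiction.\<close>

lemma partial_commute:
  fixes f :: "real^'n::finite \<Rightarrow> real"
  assumes "open S" "smooth_fun S f" "x \<in> S"
  shows "partial i (partial j f) x = partial j (partial i f) x"
proof (rule ccontr)
  assume ne: "partial i (partial j f) x \<noteq> partial j (partial i f) x"
  define e where "e = \<bar>partial i (partial j f) x - partial j (partial i f) x\<bar> / 2"
  have e: "0 < e" using ne by (simp add: e_def)
  have "\<exists>d>0. \<forall>y\<in>S. dist y x < d \<longrightarrow> dist (partial k (partial l f) y) (partial k (partial l f) x) < e"
    for k l
    using smooth_funD(3)[OF smooth_funD(1)[OF smooth_funD(1)[OF assms(2)]]] assms(3) e
    unfolding continuous_on_iff by blast
  then obtain d1 d2 where d1: "d1 > 0"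
      "\<And>y. y \<in> S \<Longrightarrow> dist y x < d1 \<Longrightarrow> dist (partial i (partial j f) y) (partial i (partial j f) x) < e"
    and d2: "d2 > 0"
      "\<And>y. y \<in> S \<Longrightarrow> dist y x < d2 \<Longrightarrow> dist (partial j (partial i f) y) (partial j (partial i f) x) < e"
    by meson
  obtain d0 where d0: "d0 > 0" "ball x d0 \<subseteq> S"
    using assms(1,3) openE by blast
  \<comment> \<open>Points of the square have distance at most \<open>2 * h\<close> from
    \<open>x\<close>, so a third of the radius leaves a strict margin.\<close>
  define h where "h = min d0 (min d1 d2) / 3"
  have h: "h > 0" "3 * h \<le> d0" "3 * h \<le> d1" "3 * h \<le> d2"
    using d0 d1 d2 by (auto simp: h_def)
  have near: "dist (x + s *\<^sub>R axis k 1 + t *\<^sub>R axis l 1) x < 3 * h"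
    if "0 \<le> s" "s \<le> h" "0 \<le> t" "t \<le> h" for s t and k l :: 'n
  proof -
    have "dist (x + s *\<^sub>R axis k 1 + t *\<^sub>R axis l 1) x = norm (s *\<^sub>R axis k (1::real) + t *\<^sub>R axis l 1)"
      by (simp add: dist_norm algebra_simps)
    also have "\<dots> \<le> s + t"
      using norm_triangle_ineq[of "s *\<^sub>R axis k (1::real)" "t *\<^sub>R axis l 1"] that by simp
    finally show ?thesis using that h by linarith
  qed
  have inS: "x + s *\<^sub>R axis k 1 + t *\<^sub>R axis l 1 \<in> S"
    if "0 \<le> s" "s \<le> h" "0 \<le> t" "t \<le> h" for s t and k l :: 'n
    using near[OF that, of k l] h d0 by (auto simp: dist_commute subset_iff)
  obtain s t where 1: "0 \<le> s" "s \<le> h" "0 \<le> t" "t \<le> h"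
    "f (x + h *\<^sub>R axis i 1 + h *\<^sub>R axis j 1) - f (x + h *\<^sub>R axis i 1) - f (x + h *\<^sub>R axis j 1) + f x =
    h * h * partial j (partial i f) (x + s *\<^sub>R axis i 1 + t *\<^sub>R axis j 1)"
    using second_difference_mean_value[OF assms(2) h(1) inS, of i j] by blast
  obtain s' t' where 2: "0 \<le> s'" "s' \<le> h" "0 \<le> t'" "t' \<le> h"
    "f (x + h *\<^sub>R axis j 1 + h *\<^sub>R axis i 1) - f (x + h *\<^sub>R axis j 1) - f (x + h *\<^sub>R axis i 1) + f x =
    h * h * partial i (partial j f) (x + s' *\<^sub>R axis j 1 + t' *\<^sub>R axis i 1)"
    using second_difference_mean_value[OF assms(2) h(1) inS, of j i] by blast
  have "h * h * partial j (partial i f) (x + s *\<^sub>R axis i 1 + t *\<^sub>R axis j 1) =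
    h * h * partial i (partial j f) (x + s' *\<^sub>R axis j 1 + t' *\<^sub>R axis i 1)"
    using 1(5) 2(5) by (simp add: algebra_simps)
  then have "partial j (partial i f) (x + s *\<^sub>R axis i 1 + t *\<^sub>R axis j 1) =
    partial i (partial j f) (x + s' *\<^sub>R axis j 1 + t' *\<^sub>R axis i 1)"
    using h(1) by simp
  moreover have "dist (partial j (partial i f) (x + s *\<^sub>R axis i 1 + t *\<^sub>R axis j 1)) (partial j (partial i f) x) < e"
    using near[OF 1(1-4), of i j] h by (intro d2(2) inS 1) linarith
  moreover have "dist (partial i (partial j f) (x + s' *\<^sub>R axis j 1 + t' *\<^sub>R axis i 1)) (partial i (partial j f) x) < e"
    using near[OF 2(1-4), of j i] h by (intro d1(2) inS 2) linarith
  ultimately have "dist (partial i (partial j f) x) (partial j (partial i f) x) < e + e"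
    by (metis dist_commute dist_triangle_less_add)
  then show False
    by (simp add: e_def dist_real_def)
qed

section \<open>Centroaffine immersions\<close>

lemma matrix_mult_matrix_inv:
  fixes A :: "'a::semiring_1^'n^'m"
  assumes "invertible A"
  shows "A ** matrix_inv A = mat 1"
  using assms someI_ex[of "\<lambda>B. A ** B = mat 1 \<and> B ** A = mat 1"]
  by (simp add: invertible_def matrix_inv_def)

text \<open>By Cramer's rule the components of the solution are quotients of determinants, hence of
  polynomials in smooth functions. No inverse matrix has to be differentiated.\<close>

lemma smooth_field_solve:
  fixes A :: "real^'n::finite \<Rightarrow> real^'n^'n" and V b :: "real^'n \<Rightarrow> real^'n"
  assumes "open S" "\<And>i j. smooth_fun S (\<lambda>x. A x $ i $ j)" "smooth_field S b"
    and "\<And>x. x \<in> S \<Longrightarrow> det (A x) \<noteq> 0" "\<And>x. x \<in> S \<Longrightarrow> A x *v V x = b x"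
  shows "smooth_field S V"
  unfolding smooth_field_def
proof
  fix k
  have det: "smooth_fun S (\<lambda>x. det (B x))" if "\<And>i j. smooth_fun S (\<lambda>x. B x $ i $ j)"
    for B :: "real^'n \<Rightarrow> real^'n^'n"
    unfolding det_def using that by (intro smooth_fun_intros assms(1))
  have B: "smooth_fun S (\<lambda>x. (\<chi> i j. if j = k then b x $ i else A x $ i $ j) $ i $ j)" for i j
    using assms(2,3) by (cases "j = k") (auto simp: smooth_field_def)
  have *: "smooth_fun S (\<lambda>x. det (\<chi> i j. if j = k then b x $ i else A x $ i $ j) / det (A x))"
    by (rule smooth_fun_divide[OF assms(1) det[OF B] det[OF assms(2)] assms(4)])
  show "smooth_fun S (\<lambda>x. V x $ k)"
  proof (rule smooth_fun_cong[OF assms(1) *])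
    fix x assume x: "x \<in> S"
    have "V x = (\<chi> k. det (\<chi> i j. if j = k then b x $ i else A x $ i $ j) / det (A x))"
      using cramer[OF assms(4)[OF x], of "V x" "b x"] assms(5)[OF x] by blast
    then show "det (\<chi> i j. if j = k then b x $ i else A x $ i $ j) / det (A x) = V x $ k"
      by simp
  qed
qed

section \<open>Calculus of vector fields and connections\<close>

lemma smooth_fieldD: "smooth_field S X \<Longrightarrow> smooth_fun S (\<lambda>x. X x $ i)"
  by (simp add: smooth_field_def)

lemma smooth_fun_inner:
  assumes "open S" "smooth_field S X" "smooth_field S Y"
  shows "smooth_fun S (\<lambda>x. X x \<bullet> Y x)"
  unfolding inner_vec_def inner_real_def
  by (intro smooth_fun_intros smooth_fieldD assms)

lemma smooth_field_grad: "smooth_fun S f \<Longrightarrow> smooth_field S (grad f)"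
  by (simp add: smooth_field_def smooth_funD)

lemma frechet_derivative_field_nth:
  fixes Y :: "real^'n::finite \<Rightarrow> real^'n"
  assumes "smooth_field S Y" "x \<in> S"
  shows "frechet_derivative Y (at x) v $ k = grad (\<lambda>y. Y y $ k) x \<bullet> v"
  by (intro frechet_derivative_vec_nth smooth_funD(2)[OF smooth_fieldD[OF assms(1)] assms(2)])

lemma smooth_field_frechet_derivative:
  fixes X Y :: "real^'n::finite \<Rightarrow> real^'n"
  assumes "open S" "smooth_field S X" "smooth_field S Y"
  shows "smooth_field S (\<lambda>x. frechet_derivative Y (at x) (X x))"
  unfolding smooth_field_def
proof
  fix k
  have "smooth_fun S (\<lambda>x. grad (\<lambda>y. Y y $ k) x \<bullet> X x)"
    using assms by (intro smooth_fun_inner smooth_field_grad smooth_fieldD)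
  then show "smooth_fun S (\<lambda>x. frechet_derivative Y (at x) (X x) $ k)"
    by (rule smooth_fun_cong[OF assms(1)]) (simp add: frechet_derivative_field_nth[OF assms(3)])
qed

lemma smooth_field_add:
  "open S \<Longrightarrow> smooth_field S X \<Longrightarrow> smooth_field S Y \<Longrightarrow> smooth_field S (\<lambda>x. X x + Y x)"
  by (simp add: smooth_field_def smooth_fun_add)

lemma smooth_field_cov_deriv:
  assumes "open S" "smooth_connection S \<Gamma>" "smooth_field S X" "smooth_field S Y"
  shows "smooth_field S (cov_deriv \<Gamma> X Y)"
proof -
  have \<Gamma>: "smooth_fun S (\<lambda>x. \<Gamma> x i j $ k)" for i j k
    using assms(2) by (simp add: smooth_connection_def smooth_field_def)
  have "smooth_field S (\<lambda>x. christoffel \<Gamma> x (X x) (Y x))"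
    unfolding smooth_field_def christoffel_def
    by (auto intro!: smooth_fun_intros assms(1) \<Gamma> smooth_fieldD[OF assms(3)] smooth_fieldD[OF assms(4)])
  then show ?thesis
    unfolding cov_deriv_def[abs_def]
    by (intro smooth_field_add smooth_field_frechet_derivative assms)
qed

lemma christoffel_commute:
  assumes "\<And>i j. \<Gamma> x i j = \<Gamma> x j i"
  shows "christoffel \<Gamma> x u v = christoffel \<Gamma> x v u"
proof -
  have "christoffel \<Gamma> x u v = (\<Sum>j\<in>UNIV. \<Sum>i\<in>UNIV. (u $ i * v $ j) *\<^sub>R \<Gamma> x i j)"
    unfolding christoffel_def by (rule sum.swap)
  also have "\<dots> = christoffel \<Gamma> x v u"
    unfolding christoffel_def
    by (intro sum.cong refl) (use assms in \<open>auto simp: mult.commute\<close>)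
  finally show ?thesis .
qed

lemma torsion_free_connectionI:
  assumes "smooth_connection S \<Gamma>" "\<And>x i j. x \<in> S \<Longrightarrow> \<Gamma> x i j = \<Gamma> x j i"
  shows "torsion_free_connection S \<Gamma>"
  unfolding torsion_free_connection_def cov_deriv_def lie_bracket_def
  using assms by (auto simp: christoffel_commute[of \<Gamma>])

text \<open>The Gauss equation of a function \<open>f\<close>, one component of a centroaffine immersion with induced
  connection \<open>\<Gamma>\<close> and affine fundamental form \<open>h\<close>.\<close>

definition gauss_eq ::
  "(real^'n::finite) set \<Rightarrow> 'n connection \<Rightarrow> (real^'n \<Rightarrow> real^'n^'n) \<Rightarrow> (real^'n \<Rightarrow> real) \<Rightarrow> bool" where
  "gauss_eq S \<Gamma> h f \<longleftrightarrow> smooth_fun S f \<and>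
    (\<forall>x\<in>S. \<forall>i j. partial i (partial j f) x = grad f x \<bullet> \<Gamma> x i j + h x $ i $ j * f x)"

lemma metric_inner_sum:
  "metric_inner h x u v = (\<Sum>i\<in>UNIV. \<Sum>j\<in>UNIV. u $ i * v $ j * h x $ i $ j)"
  by (simp add: metric_inner_def inner_vec_def matrix_vector_mult_def sum_distrib_left mult_ac)

lemma smooth_fun_metric_inner:
  assumes "open S" "\<And>i j. smooth_fun S (\<lambda>x. h x $ i $ j)" "smooth_field S X" "smooth_field S Y"
  shows "smooth_fun S (\<lambda>x. metric_inner h x (X x) (Y x))"
  unfolding metric_inner_sum
  by (intro smooth_fun_intros assms smooth_fieldD[OF assms(3)] smooth_fieldD[OF assms(4)])

lemma grad_cong:
  assumes "open S" "x \<in> S" "\<And>y. y \<in> S \<Longrightarrow> f y = g y"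
  shows "grad f x = grad g x"
  using partial_cong[OF assms] by (simp add: grad_def)

lemma grad_add:
  "f differentiable (at x) \<Longrightarrow> g differentiable (at x) \<Longrightarrow>
    grad (\<lambda>y. f y + g y) x = grad f x + grad g x"
  by (simp add: vec_eq_iff partial_add)

lemma grad_mult:
  "f differentiable (at x) \<Longrightarrow> g differentiable (at x) \<Longrightarrow>
    grad (\<lambda>y. f y * g y) x = g x *\<^sub>R grad f x + f x *\<^sub>R grad g x"
  by (simp add: vec_eq_iff partial_mult mult.commute)

lemma grad_sum_axis: "grad f x \<bullet> v = (\<Sum>i\<in>UNIV. v $ i * partial i f x)"
  by (simp add: inner_vec_def mult.commute)

lemma grad_inner_field:
  fixes X Z :: "real^'n::finite \<Rightarrow> real^'n"
  assumes "open S" "smooth_fun S f" "smooth_field S Z" "x \<in> S"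
  shows "grad (\<lambda>y. grad f y \<bullet> Z y) x \<bullet> v =
    (\<Sum>i\<in>UNIV. \<Sum>k\<in>UNIV. v $ i * Z x $ k * partial i (partial k f) x) +
    grad f x \<bullet> frechet_derivative Z (at x) v"
proof -
  have df: "partial k f differentiable (at x)" for k
    using smooth_funD assms by metis
  have dZ: "(\<lambda>y. Z y $ k) differentiable (at x)" for k
    using smooth_funD smooth_fieldD assms by metis
  have "partial i (\<lambda>y. grad f y \<bullet> Z y) x =
    (\<Sum>k\<in>UNIV. partial i (partial k f) x * Z x $ k + partial k f x * partial i (\<lambda>y. Z y $ k) x)" for i
    unfolding grad_sum_axis
    by (subst partial_sum) (auto intro!: sum.cong df dZ simp: partial_mult df dZ)
  then have "grad (\<lambda>y. grad f y \<bullet> Z y) x \<bullet> v =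
    (\<Sum>i\<in>UNIV. \<Sum>k\<in>UNIV. v $ i * Z x $ k * partial i (partial k f) x) +
    (\<Sum>i\<in>UNIV. \<Sum>k\<in>UNIV. v $ i * (partial k f x * partial i (\<lambda>y. Z y $ k) x))"
    by (subst grad_sum_axis) (simp add: sum_distrib_left algebra_simps sum.distrib)
  also have "(\<Sum>i\<in>UNIV. \<Sum>k\<in>UNIV. v $ i * (partial k f x * partial i (\<lambda>y. Z y $ k) x)) =
    (\<Sum>k\<in>UNIV. \<Sum>i\<in>UNIV. v $ i * (partial k f x * partial i (\<lambda>y. Z y $ k) x))"
    by (rule sum.swap)
  also have "\<dots> = grad f x \<bullet> frechet_derivative Z (at x) v"
    unfolding grad_sum_axis[of f] frechet_derivative_field_nth[OF assms(3,4)] grad_sum_axis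
    by (simp add: sum_distrib_left sum_distrib_right mult_ac)
  finally show ?thesis .
qed

text \<open>The Hessian terms of \<open>X (Y f)\<close> and \<open>Y (X f)\<close> cancel by
  symmetry; the derivatives of the fields remain.\<close>

lemma grad_lie_bracket:
  fixes X Y :: "real^'n::finite \<Rightarrow> real^'n"
  assumes "open S" "smooth_fun S f" "smooth_field S X" "smooth_field S Y" "x \<in> S"
  shows "grad (\<lambda>y. grad f y \<bullet> Y y) x \<bullet> X x - grad (\<lambda>y. grad f y \<bullet> X y) x \<bullet> Y x =
    grad f x \<bullet> lie_bracket X Y x"
proof -
  have "(\<Sum>i\<in>UNIV. \<Sum>k\<in>UNIV. X x $ i * Y x $ k * partial i (partial k f) x) =
    (\<Sum>k\<in>UNIV. \<Sum>i\<in>UNIV. X x $ i * Y x $ k * partial i (partial k f) x)"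
    by (rule sum.swap)
  also have "\<dots> = (\<Sum>i\<in>UNIV. \<Sum>k\<in>UNIV. Y x $ i * X x $ k * partial i (partial k f) x)"
    using partial_commute[OF assms(1,2,5)] by (intro sum.cong refl) (metis mult.commute)
  finally show ?thesis
    using assms by (simp add: grad_inner_field[OF assms(1,2) _ assms(5)] lie_bracket_def inner_diff_right)
qed

text \<open>The Gauss equation replaces the Hessian term; its Christoffel part completes the
  derivative of \<open>Z\<close> to the covariant one. This is the invariant form of
  \<open>gauss_eq\<close>.\<close>

lemma grad_gauss_eq:
  assumes "open S" "gauss_eq S \<Gamma> h f" "smooth_field S Z" "x \<in> S"
  shows "grad (\<lambda>y. grad f y \<bullet> Z y) x \<bullet> X x =
    grad f x \<bullet> cov_deriv \<Gamma> X Z x + metric_inner h x (X x) (Z x) * f x"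
proof -
  have f: "smooth_fun S f"
    and G: "partial i (partial j f) x = grad f x \<bullet> \<Gamma> x i j + h x $ i $ j * f x" for i j
    using assms by (auto simp: gauss_eq_def)
  have "(\<Sum>i\<in>UNIV. \<Sum>k\<in>UNIV. X x $ i * Z x $ k * partial i (partial k f) x) =
     grad f x \<bullet> christoffel \<Gamma> x (X x) (Z x) + metric_inner h x (X x) (Z x) * f x"
    by (simp add: G christoffel_def metric_inner_sum inner_sum_right sum_distrib_right
        sum_distrib_left distrib_left sum.distrib mult_ac)
  then show ?thesis
    by (simp add: grad_inner_field[OF assms(1) f assms(3,4)] cov_deriv_def inner_add_right)
qed

text \<open>The tangential and the transversal part of \<open>D\<^sub>X D\<^sub>Y df(Z) - D\<^sub>Y D\<^sub>X df(Z) - D\<^bsub>[X,Y]\<^esub> df(Z) = 0\<close>;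
  the coefficient \<open>C\<close> of the transversal part does not depend on \<open>f\<close>.\<close>

lemma curvature_gauss_eq:
  fixes X Y Z :: "real^'n::finite \<Rightarrow> real^'n"
  assumes S: "open S" and \<Gamma>: "smooth_connection S \<Gamma>" and h: "\<And>i j. smooth_fun S (\<lambda>x. h x $ i $ j)"
    and X: "smooth_field S X" and Y: "smooth_field S Y" and Z: "smooth_field S Z" and x: "x \<in> S"
  obtains C where "\<And>f. gauss_eq S \<Gamma> h f \<Longrightarrow>
    grad f x \<bullet> (curvature \<Gamma> X Y Z x + metric_inner h x (Y x) (Z x) *\<^sub>R X x
      - metric_inner h x (X x) (Z x) *\<^sub>R Y x) + C * f x = 0"
proof -
  define H where "H = (\<lambda>(A::real^'n \<Rightarrow> real^'n) B y. metric_inner h y (A y) (B y))"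
  \<comment> \<open>For symmetric \<Gamma> this is the Codazzi defect: the covariant derivative of
    \<open>h\<close> along \<open>X\<close> at \<open>(Y, Z)\<close> minus the one along
    \<open>Y\<close> at \<open>(X, Z)\<close>.\<close>
  define C where "C = H X (cov_deriv \<Gamma> Y Z) x - H Y (cov_deriv \<Gamma> X Z) x
    + grad (H Y Z) x \<bullet> X x - grad (H X Z) x \<bullet> Y x - H (lie_bracket X Y) Z x"
  have twice: "grad (\<lambda>y. grad (\<lambda>y. grad f y \<bullet> Z y) y \<bullet> B y) x \<bullet> A x =
      grad f x \<bullet> cov_deriv \<Gamma> A (cov_deriv \<Gamma> B Z) x + H A (cov_deriv \<Gamma> B Z) x * f x
      + (grad (H B Z) x \<bullet> A x) * f x + H B Z x * (grad f x \<bullet> A x)"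
    if f: "gauss_eq S \<Gamma> h f" and A: "smooth_field S A" and B: "smooth_field S B" for f A B
  proof -
    have c: "smooth_field S (cov_deriv \<Gamma> B Z)"
      by (intro smooth_field_cov_deriv S \<Gamma> B Z)
    have sf: "smooth_fun S f" using f by (simp add: gauss_eq_def)
    have d1: "(\<lambda>y. grad f y \<bullet> cov_deriv \<Gamma> B Z y) differentiable (at x)"
      by (rule smooth_funD(2)[OF smooth_fun_inner[OF S smooth_field_grad[OF sf] c] x])
    have d2: "H B Z differentiable (at x)"
      unfolding H_def by (rule smooth_funD(2)[OF smooth_fun_metric_inner[OF S h B Z] x])
    have d3: "f differentiable (at x)"
      using smooth_funD(2)[OF sf x] .
    have d4: "(\<lambda>y. H B Z y * f y) differentiable (at x)"
      using d2 d3 by simp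
    have "grad (\<lambda>y. grad (\<lambda>y. grad f y \<bullet> Z y) y \<bullet> B y) x =
      grad (\<lambda>y. grad f y \<bullet> cov_deriv \<Gamma> B Z y + H B Z y * f y) x"
      using grad_gauss_eq[OF S f Z] unfolding H_def by (intro grad_cong[OF S x]) auto
    also have "\<dots> = grad (\<lambda>y. grad f y \<bullet> cov_deriv \<Gamma> B Z y) x + f x *\<^sub>R grad (H B Z) x + H B Z x *\<^sub>R grad f x"
      by (simp add: grad_add[OF d1 d4] grad_mult[OF d2 d3])
    finally show ?thesis
      by (simp add: inner_add_left grad_gauss_eq[OF S f c x] H_def)
  qed
  show thesis
  proof (rule that[of C])
    fix f assume f: "gauss_eq S \<Gamma> h f"
    then have sf: "smooth_fun S f" by (simp add: gauss_eq_def)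
    have P: "smooth_fun S (\<lambda>y. grad f y \<bullet> Z y)"
      by (rule smooth_fun_inner[OF S smooth_field_grad[OF sf] Z])
    have "grad (\<lambda>y. grad f y \<bullet> Z y) x \<bullet> lie_bracket X Y x =
      grad f x \<bullet> cov_deriv \<Gamma> (lie_bracket X Y) Z x + H (lie_bracket X Y) Z x * f x"
      using grad_gauss_eq[OF S f Z x, of "lie_bracket X Y"] by (simp add: H_def)
    then show "grad f x \<bullet> (curvature \<Gamma> X Y Z x + metric_inner h x (Y x) (Z x) *\<^sub>R X x
      - metric_inner h x (X x) (Z x) *\<^sub>R Y x) + C * f x = 0"
      using grad_lie_bracket[OF S P X Y x] twice[OF f X Y] twice[OF f Y X]
      by (simp add: C_def curvature_def H_def inner_add_right inner_diff_right algebra_simps)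
  qed
qed

section \<open>Curvature and central projection of a centroaffine immersion\<close>

lemma partial_partial_mult:
  assumes "open S" "smooth_fun S f" "smooth_fun S g" "x \<in> S"
  shows "partial i (partial j (\<lambda>y. f y * g y)) x =
    partial i (partial j f) x * g x + partial j f x * partial i g x +
    partial i f x * partial j g x + f x * partial i (partial j g) x"
proof -
  have d: "f differentiable (at y)" "g differentiable (at y)" "partial j f differentiable (at y)"
    "partial j g differentiable (at y)" if "y \<in> S" for y
    using assms that smooth_funD by metis+
  have "partial i (partial j (\<lambda>y. f y * g y)) x =
    partial i (\<lambda>y. partial j f y * g y + f y * partial j g y) x"
    by (rule partial_cong[OF assms(1,4)]) (simp add: partial_mult d)
  also have "\<dots> = partial i (partial j f) x * g x + partial j f x * partial i g x +
    (partial i f x * partial j g x + f x * partial i (partial j g) x)"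
    using d[OF assms(4)] by (simp add: partial_add partial_mult)
  finally show ?thesis by simp
qed

text \<open>\<open>f\<close> and \<open>f\<^sub>0\<close> are the components of a map into
  \<open>real^'n \<times> real\<close>; \<open>f\<^sub>0\<close> is singled out as the divisor of
  the central projection. \<open>immersion\<close> combines injectivity of the differential
  (\<open>C = 0\<close>) with transversality of the position vector, since the image of
  \<open>v\<close> is \<open>- C\<close> times that vector.\<close>

locale centroaffine_immersion =
  fixes S :: "(real^'n::finite) set" and \<Gamma> :: "'n connection" and h :: "real^'n \<Rightarrow> real^'n^'n"
    and f :: "'n \<Rightarrow> real^'n \<Rightarrow> real" and f\<^sub>0 :: "real^'n \<Rightarrow> real"
  assumes S: "open S" and smooth_\<Gamma>: "smooth_connection S \<Gamma>"
    and sym: "\<And>x i j. x \<in> S \<Longrightarrow> \<Gamma> x i j = \<Gamma> x j i"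
    and smooth_h: "\<And>i j. smooth_fun S (\<lambda>x. h x $ i $ j)"
    and gauss: "\<And>k. gauss_eq S \<Gamma> h (f k)" and gauss\<^sub>0: "gauss_eq S \<Gamma> h f\<^sub>0"
    and pos: "\<And>x. x \<in> S \<Longrightarrow> 0 < f\<^sub>0 x"
    and immersion: "\<And>x v C. x \<in> S \<Longrightarrow> (\<And>k. grad (f k) x \<bullet> v + C * f k x = 0) \<Longrightarrow>
      grad f\<^sub>0 x \<bullet> v + C * f\<^sub>0 x = 0 \<Longrightarrow> v = 0"
begin

lemma torsion_free: "torsion_free_connection S \<Gamma>"
  by (intro torsion_free_connectionI smooth_\<Gamma> sym)

lemma smooth_f: "smooth_fun S (f k)" "smooth_fun S f\<^sub>0"
  using gauss gauss\<^sub>0 by (auto simp: gauss_eq_def)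

lemma curvature_eq:
  assumes "smooth_field S X" "smooth_field S Y" "smooth_field S Z" "x \<in> S"
  shows "curvature \<Gamma> X Y Z x =
    metric_inner h x (X x) (Z x) *\<^sub>R Y x - metric_inner h x (Y x) (Z x) *\<^sub>R X x"
proof -
  obtain C where C: "\<And>f. gauss_eq S \<Gamma> h f \<Longrightarrow>
    grad f x \<bullet> (curvature \<Gamma> X Y Z x + metric_inner h x (Y x) (Z x) *\<^sub>R X x
      - metric_inner h x (X x) (Z x) *\<^sub>R Y x) + C * f x = 0"
    using curvature_gauss_eq[OF S smooth_\<Gamma> smooth_h assms] by blast
  have "curvature \<Gamma> X Y Z x + metric_inner h x (Y x) (Z x) *\<^sub>R X x
      - metric_inner h x (X x) (Z x) *\<^sub>R Y x = 0"
    by (rule immersion[OF assms(4) C[OF gauss] C[OF gauss\<^sub>0]])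
  then show ?thesis by (simp add: algebra_simps)
qed

text \<open>Central projection to the hyperplane where the last coordinate is 1.\<close>

definition \<eta> :: "'n \<Rightarrow> real^'n \<Rightarrow> real" where
  "\<eta> k x = f k x / f\<^sub>0 x"

lemma smooth_\<eta>: "smooth_fun S (\<eta> k)"
  unfolding \<eta>_def[abs_def] using pos
  by (intro smooth_fun_divide S smooth_f) (simp add: less_imp_neq[symmetric])

lemma f_eq: "x \<in> S \<Longrightarrow> f k x = \<eta> k x * f\<^sub>0 x"
  using pos[of x] by (simp add: \<eta>_def)

lemma partial_f:
  assumes "x \<in> S"
  shows "partial i (f k) x = partial i (\<eta> k) x * f\<^sub>0 x + \<eta> k x * partial i f\<^sub>0 x"
proof -
  have "partial i (f k) x = partial i (\<lambda>x. \<eta> k x * f\<^sub>0 x) x"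
    by (rule partial_cong[OF S assms f_eq])
  then show ?thesis
    using smooth_funD(2)[OF smooth_\<eta> assms] smooth_funD(2)[OF smooth_f(2) assms]
    by (simp add: partial_mult)
qed

lemma grad_f:
  assumes "x \<in> S"
  shows "grad (f k) x = f\<^sub>0 x *\<^sub>R grad (\<eta> k) x + \<eta> k x *\<^sub>R grad f\<^sub>0 x"
  by (simp add: vec_eq_iff partial_f[OF assms] mult.commute)

text \<open>If all quotients are stationary along \<open>v\<close>, the immersion moves along its
  position vector, by the factor \<open>(grad f\<^sub>0 x \<bullet> v) / f\<^sub>0 x\<close>;
  transversality excludes this.\<close>

lemma \<eta>_immersion:
  assumes "x \<in> S" "\<And>k. grad (\<eta> k) x \<bullet> v = 0"
  shows "v = 0"
proof (rule immersion[OF assms(1), of v "- (grad f\<^sub>0 x \<bullet> v) / f\<^sub>0 x"])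
  show "grad (f k) x \<bullet> v + (- (grad f\<^sub>0 x \<bullet> v) / f\<^sub>0 x) * f k x = 0" for k
    using pos[OF assms(1)] assms(2)[of k]
    by (simp add: grad_f[OF assms(1)] f_eq[OF assms(1)] inner_add_left)
  show "grad f\<^sub>0 x \<bullet> v + (- (grad f\<^sub>0 x \<bullet> v) / f\<^sub>0 x) * f\<^sub>0 x = 0"
    using pos[OF assms(1)] by simp
qed

text \<open>The differential of \<open>ln f\<^sub>0\<close>. It becomes the 1-form of the projective
  change, because the second derivative of \<open>\<eta> k * f\<^sub>0\<close> has two mixed terms
  in the differentials of the factors.\<close>

definition \<sigma> :: "real^'n \<Rightarrow> real^'n" where
  "\<sigma> x = (1 / f\<^sub>0 x) *\<^sub>R grad f\<^sub>0 x"

definition \<Gamma>\<^sub>0 :: "'n connection" where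
  "\<Gamma>\<^sub>0 x i j = \<Gamma> x i j - (\<sigma> x $ i *\<^sub>R axis j 1 + \<sigma> x $ j *\<^sub>R axis i 1)"

lemma smooth_\<sigma>: "smooth_field S \<sigma>"
proof -
  have "smooth_fun S (\<lambda>x. partial i f\<^sub>0 x / f\<^sub>0 x)" for i
    using pos by (intro smooth_fun_divide smooth_funD S smooth_f) (simp add: less_imp_neq[symmetric])
  then show ?thesis by (simp add: smooth_field_def \<sigma>_def)
qed

lemma smooth_\<Gamma>\<^sub>0: "smooth_connection S \<Gamma>\<^sub>0"
  unfolding smooth_connection_def smooth_field_def \<Gamma>\<^sub>0_def
  using smooth_\<Gamma>
  by (auto intro!: smooth_fun_intros S smooth_fieldD[OF smooth_\<sigma>] simp: smooth_connection_def smooth_field_def)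

text \<open>In the second derivative of \<open>\<eta> k * f\<^sub>0\<close> the terms with
  undifferentiated \<open>\<eta> k\<close> cancel by the Gauss equation of \<open>f\<^sub>0\<close>;
  the mixed terms, divided by \<open>f\<^sub>0\<close>, are the correction in
  \<open>\<Gamma>\<^sub>0\<close>. So the \<open>\<eta> k\<close> are affine coordinates of
  \<open>\<Gamma>\<^sub>0\<close>.\<close>

lemma gauss_\<eta>: "gauss_eq S \<Gamma>\<^sub>0 (\<lambda>x. 0) (\<eta> k)"
proof -
  have "partial i (partial j (\<eta> k)) x = grad (\<eta> k) x \<bullet> \<Gamma>\<^sub>0 x i j" if x: "x \<in> S" for x i j
  proof -
    have "partial i (partial j (f k)) x = partial i (partial j (\<lambda>x. \<eta> k x * f\<^sub>0 x)) x"
      by (rule partial_cong[OF S x partial_cong[OF S _ f_eq]])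
    then have "partial i (partial j (f k)) x = partial i (partial j (\<eta> k)) x * f\<^sub>0 x
      + partial j (\<eta> k) x * partial i f\<^sub>0 x + partial i (\<eta> k) x * partial j f\<^sub>0 x
      + \<eta> k x * partial i (partial j f\<^sub>0) x"
      by (simp add: partial_partial_mult[OF S smooth_\<eta> smooth_f(2) x])
    moreover have "partial i (partial j (f k)) x = grad (f k) x \<bullet> \<Gamma> x i j + h x $ i $ j * f k x"
      "partial i (partial j f\<^sub>0) x = grad f\<^sub>0 x \<bullet> \<Gamma> x i j + h x $ i $ j * f\<^sub>0 x"
      using gauss gauss\<^sub>0 x by (auto simp: gauss_eq_def)
    ultimately have "f\<^sub>0 x * (partial i (partial j (\<eta> k)) x) = f\<^sub>0 x * (grad (\<eta> k) x \<bullet> \<Gamma> x i j)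
      - (partial j (\<eta> k) x * partial i f\<^sub>0 x + partial i (\<eta> k) x * partial j f\<^sub>0 x)"
      by (simp add: grad_f[OF x] f_eq[OF x] inner_add_left algebra_simps)
    also have "\<dots> = f\<^sub>0 x * (grad (\<eta> k) x \<bullet> \<Gamma>\<^sub>0 x i j)"
      using pos[OF x] by (simp add: \<Gamma>\<^sub>0_def \<sigma>_def inner_diff_right inner_add_right field_simps)
    finally show ?thesis using pos[OF x] by simp
  qed
  then show ?thesis by (simp add: gauss_eq_def smooth_\<eta>)
qed

lemma christoffel_\<Gamma>\<^sub>0:
  "christoffel \<Gamma> x u v = christoffel \<Gamma>\<^sub>0 x u v + (\<sigma> x \<bullet> u) *\<^sub>R v + (\<sigma> x \<bullet> v) *\<^sub>R u"
proof -
  have swap: "(\<Sum>a\<in>UNIV. \<Sum>b\<in>UNIV. if i = a then g a b else 0) = (\<Sum>b\<in>UNIV. g i b)"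
    for g :: "'n \<Rightarrow> 'n \<Rightarrow> real" and i
    by (subst sum.swap) simp
  have "christoffel \<Gamma> x u v - christoffel \<Gamma>\<^sub>0 x u v =
    (\<Sum>i\<in>UNIV. \<Sum>j\<in>UNIV. (u $ i * v $ j) *\<^sub>R (\<sigma> x $ i *\<^sub>R axis j 1 + \<sigma> x $ j *\<^sub>R axis i 1))"
    unfolding christoffel_def \<Gamma>\<^sub>0_def sum_subtractf[symmetric] by (simp add: scaleR_diff_right)
  also have "\<dots> = (\<sigma> x \<bullet> u) *\<^sub>R v + (\<sigma> x \<bullet> v) *\<^sub>R u"
    by (simp add: vec_eq_iff axis_def inner_vec_def distrib_left sum.distrib sum_distrib_left
      sum_distrib_right if_distrib[where f = "\<lambda>c. _ * c"] mult_ac swap cong: if_cong)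
  finally show ?thesis by (simp add: algebra_simps)
qed

lemma projectively_flat: "projectively_flat S \<Gamma>"
  unfolding projectively_flat_def
proof (intro conjI exI[of _ \<Gamma>\<^sub>0] exI[of _ \<sigma>] allI impI ballI torsion_free smooth_\<sigma>)
  show "torsion_free_connection S \<Gamma>\<^sub>0"
    by (intro torsion_free_connectionI smooth_\<Gamma>\<^sub>0) (simp add: \<Gamma>\<^sub>0_def sym)
  show "flat_connection S \<Gamma>\<^sub>0"
    unfolding flat_connection_def
  proof (intro allI impI ballI)
    fix X Y Z :: "real^'n \<Rightarrow> real^'n" and x
    assume *: "smooth_field S X" "smooth_field S Y" "smooth_field S Z" "x \<in> S"
    have h0: "smooth_fun S (\<lambda>x. (0::real^'n^'n) $ i $ j)" for i j by auto
    obtain C where C: "\<And>f. gauss_eq S \<Gamma>\<^sub>0 (\<lambda>x. 0) f \<Longrightarrow>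
       grad f x \<bullet> (curvature \<Gamma>\<^sub>0 X Y Z x + metric_inner (\<lambda>x. 0) x (Y x) (Z x) *\<^sub>R X x
      - metric_inner (\<lambda>x. 0) x (X x) (Z x) *\<^sub>R Y x) + C * f x = 0"
      using curvature_gauss_eq[OF S smooth_\<Gamma>\<^sub>0 h0 *] by blast
    \<comment> \<open>The last component of the projected immersion is the constant 1; its equation
      isolates the transversal coefficient and gives \<open>C = 0\<close>.\<close>
    have "gauss_eq S \<Gamma>\<^sub>0 (\<lambda>x. 0) (\<lambda>x. 1)"
      by (auto simp: gauss_eq_def grad_sum_axis)
    from C[OF this] have "C = 0"
      by (simp add: grad_sum_axis)
    then show "curvature \<Gamma>\<^sub>0 X Y Z x = 0"
      using C[OF gauss_\<eta>] by (intro \<eta>_immersion[OF *(4)]) (simp add: metric_inner_def)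
  qed
  fix X Y :: "real^'n \<Rightarrow> real^'n" and x
  show "cov_deriv \<Gamma> X Y x = cov_deriv \<Gamma>\<^sub>0 X Y x + (\<sigma> x \<bullet> X x) *\<^sub>R Y x + (\<sigma> x \<bullet> Y x) *\<^sub>R X x"
    by (simp add: cov_deriv_def christoffel_\<Gamma>\<^sub>0)
qed

end

section \<open>Geodesics\<close>

text \<open>The equation \<open>s' = C / p(s)\<close> is solved by separation: \<open>s\<close>
  inverts the normalised antiderivative of \<open>p\<close>, and \<open>C\<close> is the total
  integral, so that \<open>s 1 = 1\<close>.\<close>

lemma reparametrization_of_interval:
  fixes p :: "real \<Rightarrow> real"
  assumes p: "continuous_on {0..1} p" and pos: "\<And>t. t \<in> {0..1} \<Longrightarrow> 0 < p t"
  obtains s C where "0 < C" "s 0 = 0" "s 1 = 1"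
    "\<And>t. t \<in> {0..1} \<Longrightarrow> s t \<in> {0..1} \<and> (s has_real_derivative C / p (s t)) (at t within {0..1})"
proof -
  \<comment> \<open>Constant extension beyond the unit interval makes 0 and 1 interior points, so
    the inverse function rule with two-sided derivatives applies there too.\<close>
  define P where "P t = p (max 0 (min 1 t))" for t
  have P: "continuous_on {-2..3} P" unfolding P_def
    by (intro continuous_on_compose2[OF p] continuous_intros) auto
  have P_pos: "0 < P t" for t by (simp add: P_def pos)
  obtain G where G: "\<And>t. t \<in> {-2..3} \<Longrightarrow> (G has_vector_derivative P t) (at t within {-2..3})"
    using antiderivative_continuous[OF P] by blast
  have G': "(G has_real_derivative P t) (at t)" if "-2 < t" "t < 3" for t
    using G[of t] that at_within_Icc_at[of "-2" t 3]
    by (simp add: has_real_derivative_iff_has_vector_derivative)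
  have mono: "G x < G y" if "-1 \<le> x" "x < y" "y \<le> 2" for x y
    by (rule DERIV_pos_imp_increasing[OF that(2)]) (use that P_pos G' in \<open>force intro!: exI[of _ "P _"]\<close>)
  define C where "C = G 1 - G 0"
  have C: "0 < C" using mono[of 0 1] by (simp add: C_def)
  define T where "T t = (G t - G 0) / C" for t
  have T01: "T 0 = 0" "T 1 = 1" using C by (auto simp: T_def C_def)
  have T': "(T has_real_derivative P t / C) (at t)" if "-2 < t" "t < 3" for t
    unfolding T_def using C by (auto intro!: derivative_eq_intros G' that)
  have Tmono: "T x < T y" if "-1 \<le> x" "x < y" "y \<le> 2" for x y
    using mono[OF that] C by (simp add: T_def divide_strict_right_mono)
  have Tinj: "inj_on T {-1..2}"
    by (rule linorder_inj_onI) (use Tmono in \<open>force\<close>)+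
  define s where "s = inv_into {-1..2} T"
  have sT: "s (T t) = t" if "-1 \<le> t" "t \<le> 2" for t
    unfolding s_def using Tinj that by (simp add: inv_into_f_f)
  have Tcont: "isCont T t" if "-1 \<le> t" "t \<le> 2" for t
    using T'[of t] that DERIV_isCont by force
  have ivt: "\<exists>t\<ge>-1. t \<le> 2 \<and> T t = y" if "T (-1) < y" "y < T 2" for y
    by (rule IVT) (use that Tcont in auto)
  show thesis
  proof (rule that[of C s])
    show "0 < C" by fact
    show s0: "s 0 = 0" and s1: "s 1 = 1" using sT[of 0] sT[of 1] T01 by auto
    fix t :: real assume t: "t \<in> {0..1}"
    have lt: "T (-1) < t" "t < T 2"
      using Tmono[of "-1" 0] Tmono[of 1 2] T01 t by auto
    obtain \<tau> where \<tau>: "-1 \<le> \<tau>" "\<tau> \<le> 2" "T \<tau> = t"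
      using ivt[OF lt] by blast
    have \<tau>01: "\<tau> \<in> {0..1}"
    proof (rule ccontr)
      assume "\<tau> \<notin> {0..1}"
      then show False
        using Tmono[of \<tau> 0] Tmono[of 1 \<tau>] \<tau> T01 t by (auto simp: not_le)
    qed
    have s\<tau>: "s t = \<tau>" using sT \<tau> by auto
    have cont: "isCont s (T \<tau>)"
      by (rule isCont_inverse_function2[of "-1" \<tau> 2]) (use \<tau>01 sT Tcont in auto)
    have "(s has_real_derivative inverse (P \<tau> / C)) (at t)"
    proof (rule DERIV_inverse_function[where f = T and g = s and a = "T (-1)" and b = "T 2"])
      show "(T has_real_derivative P \<tau> / C) (at (s t))"
        using T'[of \<tau>] \<tau> s\<tau> by simp
      show "T (s y) = y" if "T (-1) < y" "y < T 2" for y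
        using ivt[OF that] sT by auto
    qed (use lt C P_pos[of \<tau>] cont \<tau> in auto)
    moreover have "P \<tau> = p (s t)" using \<tau>01 s\<tau> by (simp add: P_def)
    ultimately show "s t \<in> {0..1} \<and> (s has_real_derivative C / p (s t)) (at t within {0..1})"
      using \<tau>01 s\<tau> by (auto intro: has_field_derivative_at_within)
  qed
qed

lemma has_real_derivative_along_curve:
  assumes "f differentiable (at (c t))" "(c has_vector_derivative w) (at t within T)"
  shows "((\<lambda>t. f (c t)) has_real_derivative grad f (c t) \<bullet> w) (at t within T)"
  using has_derivative_compose[OF assms(2)[unfolded has_vector_derivative_def] has_derivative_grad[OF assms(1)]]
  by (simp add: has_field_derivative_def mult_commute_abs)

text \<open>The Christoffel part of the Gauss equation completes the acceleration to the covariant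
  one. Along a geodesic, \<open>u = f \<circ> c\<close> therefore solves
  \<open>u'' = h(v,v) u\<close>. Working within \<open>T\<close> includes one-sided
  derivatives.\<close>

lemma second_derivative_along_curve:
  fixes c v :: "real \<Rightarrow> real^'n::finite"
  assumes f: "gauss_eq S \<Gamma> h f" and x: "c t \<in> S"
    and c: "(c has_vector_derivative v t) (at t within T)" and v: "(v has_vector_derivative a) (at t within T)"
  shows "((\<lambda>t. grad f (c t) \<bullet> v t) has_real_derivative
    grad f (c t) \<bullet> (a + christoffel \<Gamma> (c t) (v t) (v t)) + metric_inner h (c t) (v t) (v t) * f (c t))
    (at t within T)"
proof -
  have sf: "smooth_fun S f"
    and G: "partial i (partial j f) (c t) = grad f (c t) \<bullet> \<Gamma> (c t) i j + h (c t) $ i $ j * f (c t)" for i j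
    using f x by (auto simp: gauss_eq_def)
  have vk: "((\<lambda>t. v t $ k) has_real_derivative a $ k) (at t within T)" for k
    using bounded_linear.has_vector_derivative[OF bounded_linear_vec_nth v]
    by (simp add: has_real_derivative_iff_has_vector_derivative)
  have pk: "((\<lambda>t. partial k f (c t)) has_real_derivative grad (partial k f) (c t) \<bullet> v t) (at t within T)" for k
    by (intro has_real_derivative_along_curve c smooth_funD(2)[OF smooth_funD(1)[OF sf] x])
  have "((\<lambda>t. \<Sum>k\<in>UNIV. v t $ k * partial k f (c t)) has_real_derivative
    (\<Sum>k\<in>UNIV. a $ k * partial k f (c t) + (grad (partial k f) (c t) \<bullet> v t) * v t $ k)) (at t within T)"
    by (intro DERIV_sum DERIV_mult vk pk)
  moreover have "(\<Sum>k\<in>UNIV. (grad (partial k f) (c t) \<bullet> v t) * v t $ k) =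
    grad f (c t) \<bullet> christoffel \<Gamma> (c t) (v t) (v t) + metric_inner h (c t) (v t) (v t) * f (c t)"
  proof -
    have "(\<Sum>k\<in>UNIV. (grad (partial k f) (c t) \<bullet> v t) * v t $ k) =
      (\<Sum>k\<in>UNIV. \<Sum>i\<in>UNIV. v t $ i * v t $ k * partial i (partial k f) (c t))"
      by (simp add: grad_sum_axis sum_distrib_right sum_distrib_left mult_ac)
    also have "\<dots> = (\<Sum>i\<in>UNIV. \<Sum>k\<in>UNIV. v t $ i * v t $ k * partial i (partial k f) (c t))"
      by (rule sum.swap)
    also have "\<dots> = grad f (c t) \<bullet> christoffel \<Gamma> (c t) (v t) (v t) + metric_inner h (c t) (v t) (v t) * f (c t)"
      by (simp add: G christoffel_def metric_inner_sum inner_sum_right sum_distrib_right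
        sum_distrib_left distrib_left sum.distrib mult_ac)
    finally show ?thesis .
  qed
  ultimately show ?thesis
    unfolding grad_sum_axis[of f "c _" "v _"]
    by (simp add: sum.distrib inner_add_right grad_sum_axis[of f _ a] add_ac)
qed

lemma has_vector_derivative_velocity:
  "c differentiable (at t within {0..1}) \<Longrightarrow> (c has_vector_derivative velocity c t) (at t within {0..1})"
  by (simp add: velocity_def vector_derivative_works[symmetric])

lemma velocity_eqI:
  assumes "(c has_vector_derivative v) (at t within {0..1})" "t \<in> {0..1}"
  shows "velocity c t = v"
  unfolding velocity_def
  by (rule vector_derivative_within_closed_interval) (use assms in auto)

context centroaffine_immersion
begin

text \<open>The quantity is the Wronskian of \<open>f\<^sub>0\<close> and \<open>f k\<close> along
  the curve, written through their quotient. Differentiating \<open>(f\<^sub>0)\<^sup>2\<close>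
  supplies exactly the term \<open>2 \<sigma>(v) v\<close> by which \<open>\<Gamma>\<close> exceeds
  \<open>\<Gamma>\<^sub>0\<close> on \<open>(v, v)\<close>.\<close>

lemma has_real_derivative_Wronskian:
  fixes c v :: "real \<Rightarrow> real^'n"
  assumes x: "c t \<in> S"
    and c: "(c has_vector_derivative v t) (at t within T)" and v: "(v has_vector_derivative a) (at t within T)"
  shows "((\<lambda>t. (f\<^sub>0 (c t))\<^sup>2 * (grad (\<eta> k) (c t) \<bullet> v t)) has_real_derivative
    (f\<^sub>0 (c t))\<^sup>2 * (grad (\<eta> k) (c t) \<bullet> (a + christoffel \<Gamma> (c t) (v t) (v t)))) (at t within T)"
proof -
  have d0: "((\<lambda>t. f\<^sub>0 (c t)) has_real_derivative grad f\<^sub>0 (c t) \<bullet> v t) (at t within T)"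
    by (rule has_real_derivative_along_curve[OF smooth_funD(2)[OF smooth_f(2) x] c])
  have d\<eta>: "((\<lambda>t. grad (\<eta> k) (c t) \<bullet> v t) has_real_derivative
    grad (\<eta> k) (c t) \<bullet> (a + christoffel \<Gamma>\<^sub>0 (c t) (v t) (v t))) (at t within T)"
    using second_derivative_along_curve[OF gauss_\<eta> x c v] by (simp add: metric_inner_def)
  have "grad (\<eta> k) (c t) \<bullet> christoffel \<Gamma> (c t) (v t) (v t) = grad (\<eta> k) (c t) \<bullet> christoffel \<Gamma>\<^sub>0 (c t) (v t) (v t)
    + 2 * ((grad f\<^sub>0 (c t) \<bullet> v t) / f\<^sub>0 (c t)) * (grad (\<eta> k) (c t) \<bullet> v t)"
    unfolding christoffel_\<Gamma>\<^sub>0 inner_add_right inner_scaleR_right by (simp add: \<sigma>_def)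
  then show ?thesis
    unfolding power2_eq_square
    by (intro DERIV_cong[OF DERIV_mult[OF DERIV_mult[OF d0 d0] d\<eta>]])
      (use pos[OF x] in \<open>simp add: inner_add_right field_simps\<close>)
qed

text \<open>Constancy of the Wronskians makes every chart component move at a fixed multiple of
  \<open>1 / (f\<^sub>0)\<^sup>2\<close>. Integration gives \<open>m\<close> as
  \<open>(f\<^sub>0 a)\<^sup>2\<close> times the integral of that function, the same for all
  \<open>k\<close>.\<close>

lemma geodesic_displacement:
  assumes "geodesic_from_to S \<Gamma> a b c"
  obtains m where "0 < m" "\<And>k. \<eta> k b - \<eta> k a = m * (grad (\<eta> k) a \<bullet> velocity c 0)"
proof -
  have c01: "c 0 = a" "c 1 = b" and cS: "\<And>t. t \<in> {0..1} \<Longrightarrow> c t \<in> S"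
    and dc: "\<And>t. t \<in> {0..1} \<Longrightarrow> (c has_vector_derivative velocity c t) (at t within {0..1})"
    and dv: "\<And>t. t \<in> {0..1} \<Longrightarrow>
      (velocity c has_vector_derivative velocity (velocity c) t) (at t within {0..1})"
    and geo: "\<And>t. t \<in> {0..1} \<Longrightarrow>
      velocity (velocity c) t + christoffel \<Gamma> (c t) (velocity c t) (velocity c t) = 0"
    using assms by (auto simp: geodesic_from_to_def intro: has_vector_derivative_velocity)
  have const: "(f\<^sub>0 (c t))\<^sup>2 * (grad (\<eta> k) (c t) \<bullet> velocity c t) = (f\<^sub>0 a)\<^sup>2 * (grad (\<eta> k) a \<bullet> velocity c 0)"
    if t: "t \<in> {0..1}" for k t
  proof -
    have "((\<lambda>t. (f\<^sub>0 (c t))\<^sup>2 * (grad (\<eta> k) (c t) \<bullet> velocity c t)) has_real_derivative 0) (at t within {0..1})"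
      if "t \<in> {0..1}" for t
      using has_real_derivative_Wronskian[OF cS dc dv, of t k] that geo[OF that] by simp
    from has_field_derivative_zero_constant[OF _ this]
    obtain K where "\<And>t. t \<in> {0..1} \<Longrightarrow> (f\<^sub>0 (c t))\<^sup>2 * (grad (\<eta> k) (c t) \<bullet> velocity c t) = K"
      by auto
    from this[OF t] this[of 0] show ?thesis by (simp add: c01)
  qed
  have "continuous_on {0..1} c"
    using dc by (meson continuous_on_eq_continuous_within has_vector_derivative_continuous)
  then have "continuous_on {0..1} (\<lambda>t. f\<^sub>0 (c t))"
    using cS by (intro continuous_on_compose2[OF smooth_funD(3)[OF smooth_f(2)]]) auto
  then have "continuous_on {0..1} (\<lambda>t. 1 / (f\<^sub>0 (c t))\<^sup>2)"
    using cS pos by (intro continuous_intros) (auto simp: less_imp_neq[symmetric])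
  then obtain g where g: "\<And>t. t \<in> {0..1} \<Longrightarrow>
      (g has_real_derivative 1 / (f\<^sub>0 (c t))\<^sup>2) (at t within {0..1})"
    using antiderivative_continuous by (metis has_real_derivative_iff_has_vector_derivative)
  have "\<exists>t\<in>{0<..<1}. g 1 - g 0 = (1 / (f\<^sub>0 (c t))\<^sup>2) * (1 - 0)"
    by (rule mvt_simple[of 0 1 g "\<lambda>t. (*) (1 / (f\<^sub>0 (c t))\<^sup>2)"])
      (rule zero_less_one, rule g[unfolded has_field_derivative_def], simp)
  then have g01: "g 0 < g 1"
    using pos[OF cS] by (smt (verit, best) atLeastAtMost_iff divide_pos_pos greaterThanLessThan_iff
      mult_cancel_left1 zero_less_power)
  show thesis
  proof (rule that[of "(f\<^sub>0 a)\<^sup>2 * (g 1 - g 0)"])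
    show "0 < (f\<^sub>0 a)\<^sup>2 * (g 1 - g 0)"
      using g01 pos[OF cS[of 0]] c01 by simp
    fix k
    let ?K = "(f\<^sub>0 a)\<^sup>2 * (grad (\<eta> k) a \<bullet> velocity c 0)"
    have "((\<lambda>t. \<eta> k (c t) - ?K * g t) has_real_derivative 0) (at t within {0..1})" if t: "t \<in> {0..1}" for t
    proof -
      have "grad (\<eta> k) (c t) \<bullet> velocity c t = ?K * (1 / (f\<^sub>0 (c t))\<^sup>2)"
        using const[OF t, of k] pos[OF cS[OF t]] by (simp add: field_simps)
      with has_real_derivative_along_curve[OF smooth_funD(2)[OF smooth_\<eta> cS[OF t]] dc[OF t], of k]
      have "((\<lambda>t. \<eta> k (c t)) has_real_derivative ?K * (1 / (f\<^sub>0 (c t))\<^sup>2)) (at t within {0..1})"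
        by simp
      from DERIV_diff[OF this DERIV_cmult[OF g[OF t], of ?K]] show ?thesis by simp
    qed
    from has_field_derivative_zero_constant[OF _ this]
    obtain K where "\<And>t. t \<in> {0..1} \<Longrightarrow> \<eta> k (c t) - ?K * g t = K"
      by auto
    from this[of 0] this[of 1]
    show "\<eta> k b - \<eta> k a = (f\<^sub>0 a)\<^sup>2 * (g 1 - g 0) * (grad (\<eta> k) a \<bullet> velocity c 0)"
      by (simp add: c01 algebra_simps)
  qed
qed

section \<open>Existence of geodesics from segments in the chart\<close>

definition chart :: "real^'n \<Rightarrow> real^'n" where
  "chart x = (\<chi> k. \<eta> k x)"

definition J :: "real^'n \<Rightarrow> real^'n^'n" where
  "J x = (\<chi> k i. partial i (\<eta> k) x)"

lemma J_mult: "(J x *v v) $ k = grad (\<eta> k) x \<bullet> v"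
  by (simp add: J_def matrix_vector_mult_def grad_sum_axis mult.commute)

lemma has_derivative_chart:
  assumes "x \<in> S"
  shows "(chart has_derivative (\<lambda>v. J x *v v)) (at x)"
  unfolding has_derivative_componentwise_within[of chart]
  by (auto simp: Basis_vec_def inner_axis chart_def J_mult
    intro!: has_derivative_grad smooth_funD(2)[OF smooth_\<eta> assms])

lemma invertible_J:
  assumes "x \<in> S"
  shows "invertible (J x)"
proof -
  have "\<exists>B. B ** J x = mat 1"
    unfolding matrix_left_invertible_ker
    using \<eta>_immersion[OF assms] by (metis J_mult zero_index)
  then show ?thesis
    by (simp add: invertible_left_inverse)
qed

text \<open>The segment is pulled back by the inverse chart and traversed at the speed that makes
  all Wronskians constant; the covariant acceleration then vanishes by
  \<open>\<eta>_immersion\<close>.\<close>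

lemma geodesic_exists:
  assumes inj: "inj_on chart S" and a: "a \<in> S" and b: "b \<in> S"
    and seg: "closed_segment (chart a) (chart b) \<subseteq> chart ` S"
  shows "\<exists>c. geodesic_from_to S \<Gamma> a b c"
proof -
  define g where "g = inv_into S chart"
  define v where "v = chart b - chart a"
  define V where "V x = matrix_inv (J x) *v v" for x
  have g_chart: "g (chart x) = x" if "x \<in> S" for x
    using inj that by (simp add: g_def)
  have JV: "J x *v V x = v" if "x \<in> S" for x
    using invertible_J[OF that] by (simp add: V_def matrix_vector_mul_assoc matrix_mult_matrix_inv)
  have smooth_V: "smooth_field S V"
  proof (rule smooth_field_solve[OF S _ _ _ JV])
    show "smooth_fun S (\<lambda>x. J x $ i $ j)" for i j
      by (simp add: J_def smooth_funD smooth_\<eta>)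
    show "smooth_field S (\<lambda>x. v)"
      by (auto simp: smooth_field_def)
    show "det (J x) \<noteq> 0" if "x \<in> S" for x
      using invertible_J[OF that] by (simp add: invertible_det_nz)
  qed
  have dg: "(g has_derivative (\<lambda>v. matrix_inv (J x) *v v)) (at (chart x))" if "x \<in> S" for x
  proof (rule has_derivative_inverse_strong[OF S that _ g_chart has_derivative_chart[OF that]])
    show "continuous_on S chart"
      using has_derivative_chart by (meson continuous_at_imp_continuous_on has_derivative_continuous)
    show "(\<lambda>v. J x *v v) \<circ> (\<lambda>v. matrix_inv (J x) *v v) = id"
      using invertible_J[OF that] by (auto simp: fun_eq_iff matrix_vector_mul_assoc matrix_mult_matrix_inv)
  qed
  have line: "chart a + s *\<^sub>R v \<in> chart ` S" if "s \<in> {0..1}" for s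
    using seg that by (auto simp: closed_segment_image_interval v_def algebra_simps image_subset_iff)
  have gS: "g (chart a + s *\<^sub>R v) \<in> S" and chart_g: "chart (g (chart a + s *\<^sub>R v)) = chart a + s *\<^sub>R v"
    if "s \<in> {0..1}" for s
    using line[OF that] by (auto simp: g_def inv_into_into f_inv_into_f)
  \<comment> \<open>A constant Wronskian requires chart speed inversely proportional to
    \<open>(f\<^sub>0)\<^sup>2\<close>, hence the equation \<open>s' = C / p(s)\<close>.\<close>
  define p where "p s = (f\<^sub>0 (g (chart a + s *\<^sub>R v)))\<^sup>2" for s
  have "continuous_on {0..1} (\<lambda>s. g (chart a + s *\<^sub>R v))"
  proof (rule continuous_on_compose2[of "chart ` S" g])
    show "continuous_on (chart ` S) g"
      using dg has_derivative_continuous by (intro continuous_at_imp_continuous_on) blast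
  qed (use line in \<open>auto intro!: continuous_intros\<close>)
  then have p: "continuous_on {0..1} p"
    unfolding p_def using gS
    by (intro continuous_intros continuous_on_compose2[OF smooth_funD(3)[OF smooth_f(2)]]) auto
  have p_pos: "0 < p s" if "s \<in> {0..1}" for s
    using pos[OF gS[OF that]] by (simp add: p_def)
  obtain s C where C: "0 < C" and s01: "s 0 = 0" "s 1 = 1"
    and s: "\<And>t. t \<in> {0..1} \<Longrightarrow> s t \<in> {0..1}"
    and ds: "\<And>t. t \<in> {0..1} \<Longrightarrow> (s has_real_derivative C / p (s t)) (at t within {0..1})"
    using reparametrization_of_interval[OF p p_pos] by metis
  define c where "c t = g (chart a + s t *\<^sub>R v)" for t
  \<comment> \<open>The velocity of \<open>c\<close> is the value of a smooth field at the current
    point, so it is differentiable without a second derivative of \<open>g\<close>.\<close>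
  define U where "U x = (C / (f\<^sub>0 x)\<^sup>2) *\<^sub>R V x" for x
  have cS: "c t \<in> S" and chart_c: "chart (c t) = chart a + s t *\<^sub>R v" if "t \<in> {0..1}" for t
    using gS chart_g s[OF that] by (auto simp: c_def)
  have dc: "(c has_vector_derivative U (c t)) (at t within {0..1})" if t: "t \<in> {0..1}" for t
  proof -
    have "((\<lambda>t. chart a + s t *\<^sub>R v) has_vector_derivative (C / p (s t)) *\<^sub>R v) (at t within {0..1})"
      using ds[OF t] by (auto intro!: derivative_eq_intros)
    then have "((\<lambda>t. chart a + s t *\<^sub>R v) has_derivative (\<lambda>h. h *\<^sub>R ((C / p (s t)) *\<^sub>R v))) (at t within {0..1})"
      by (simp add: has_vector_derivative_def)
    from has_derivative_compose[OF this, of g "\<lambda>v. matrix_inv (J (c t)) *v v"]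
    have "(c has_derivative (\<lambda>h. matrix_inv (J (c t)) *v (h *\<^sub>R ((C / p (s t)) *\<^sub>R v)))) (at t within {0..1})"
      using dg[OF cS[OF t], unfolded chart_c[OF t]] by (simp add: c_def[abs_def])
    then show ?thesis
      by (simp add: has_vector_derivative_def U_def V_def p_def c_def matrix_vector_mult_scaleR)
  qed
  have vel: "velocity c t = U (c t)" if "t \<in> {0..1}" for t
    using dc[OF that] that by (rule velocity_eqI)
  have "smooth_field S U"
    unfolding smooth_field_def U_def using pos smooth_fieldD[OF smooth_V]
    by (auto intro!: smooth_fun_intros smooth_fun_divide S smooth_f(2) simp: power2_eq_square less_imp_neq[symmetric])
  then have dU: "\<exists>U'. (U has_derivative U') (at x)" if "x \<in> S" for x
  proof -
    have "(U has_derivative (\<lambda>v. \<chi> k. grad (\<lambda>y. U y $ k) x \<bullet> v)) (at x)"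
      unfolding has_derivative_componentwise_within[of U]
      by (auto simp: Basis_vec_def inner_axis intro!: has_derivative_grad
        smooth_funD(2)[OF smooth_fieldD[OF \<open>smooth_field S U\<close>] that])
    then show ?thesis by blast
  qed
  have dv: "velocity c differentiable (at t within {0..1})" if t: "t \<in> {0..1}" for t
  proof -
    obtain U' where "(U has_derivative U') (at (c t))" using dU[OF cS[OF t]] by blast
    from has_derivative_compose[OF dc[OF t, unfolded has_vector_derivative_def] this]
    have "(\<lambda>t. U (c t)) differentiable (at t within {0..1})"
      by (auto simp: differentiable_def)
    then show ?thesis
      using vel t unfolding differentiable_def
      by (metis (no_types, lifting) has_derivative_transform)
  qed
  have "velocity (velocity c) t + christoffel \<Gamma> (c t) (velocity c t) (velocity c t) = 0"
    if t: "t \<in> {0..1}" for t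
  proof (rule \<eta>_immersion[OF cS[OF t]])
    fix k
    let ?w = "(f\<^sub>0 (c t))\<^sup>2 * (grad (\<eta> k) (c t) \<bullet>
      (velocity (velocity c) t + christoffel \<Gamma> (c t) (velocity c t) (velocity c t)))"
    have c': "(c has_vector_derivative velocity c t) (at t within {0..1})"
      using dc[OF t] vel[OF t] by simp
    have "((\<lambda>t. (f\<^sub>0 (c t))\<^sup>2 * (grad (\<eta> k) (c t) \<bullet> velocity c t)) has_real_derivative ?w) (at t within {0..1})"
      by (rule has_real_derivative_Wronskian[OF cS[OF t] c' has_vector_derivative_velocity[OF dv[OF t]]])
    \<comment> \<open>The factor \<open>(f\<^sub>0)\<^sup>2\<close> cancels the denominator in
      \<open>U\<close>, and \<open>J x *v V x = v\<close>. The Wronskian is constant, so its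
      derivative \<open>?w\<close> is zero.\<close>
    moreover have "(f\<^sub>0 (c t))\<^sup>2 * (grad (\<eta> k) (c t) \<bullet> velocity c t) = C * v $ k" if "t \<in> {0..1}" for t
      using JV[OF cS[OF that]] pos[OF cS[OF that]] J_mult[of "c t" "V (c t)" k]
      by (simp add: vel[OF that] U_def)
    ultimately have "((\<lambda>t. C * v $ k) has_real_derivative ?w) (at t within {0..1})"
      using t unfolding has_field_derivative_def
      by (metis (mono_tags, lifting) has_derivative_transform)
    then have "?w = vector_derivative (\<lambda>t. C * v $ k) (at t within {0..1})"
      using t by (intro vector_derivative_within_closed_interval[symmetric])
        (auto simp: has_real_derivative_iff_has_vector_derivative)
    also have "\<dots> = 0"
      by (rule vector_derivative_within_closed_interval) (use t in auto)
    finally show "grad (\<eta> k) (c t) \<bullet>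
      (velocity (velocity c) t + christoffel \<Gamma> (c t) (velocity c t) (velocity c t)) = 0"
      using pos[OF cS[OF t]] by simp
  qed
  moreover have "c 0 = a" "c 1 = b"
    using g_chart a b by (auto simp: c_def s01 v_def)
  moreover have "c differentiable (at t within {0..1})" if "t \<in> {0..1}" for t
    using dc[OF that] by (auto simp: differentiable_def has_vector_derivative_def)
  ultimately show ?thesis
    using cS dv by (intro exI[of _ c]) (auto simp: geodesic_from_to_def)
qed

end

section \<open>Derivatives of the divergence\<close>

text \<open>Bundling differentiability with the value lets derivatives of compound expressions be
  computed by chaining introduction rules.\<close>

definition has_partial :: "'n::finite \<Rightarrow> (real^'n \<Rightarrow> real) \<Rightarrow> real \<Rightarrow> real^'n \<Rightarrow> bool" where
  "has_partial i f d x \<longleftrightarrow> f differentiable (at x) \<and> partial i f x = d"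

lemma has_partialI: "f differentiable (at x) \<Longrightarrow> has_partial i f (partial i f x) x"
  by (simp add: has_partial_def)

lemma has_partial_const: "has_partial i (\<lambda>x. c) 0 x"
  by (simp add: has_partial_def)

lemma has_partial_add:
  "has_partial i f f' x \<Longrightarrow> has_partial i g g' x \<Longrightarrow> has_partial i (\<lambda>x. f x + g x) (f' + g') x"
  by (auto simp: has_partial_def partial_add)

lemma has_partial_diff:
  "has_partial i f f' x \<Longrightarrow> has_partial i g g' x \<Longrightarrow> has_partial i (\<lambda>x. f x - g x) (f' - g') x"
  by (auto simp: has_partial_def partial_diff)

lemma has_partial_mult:
  "has_partial i f f' x \<Longrightarrow> has_partial i g g' x \<Longrightarrow>
    has_partial i (\<lambda>x. f x * g x) (f' * g x + f x * g') x"
  by (auto simp: has_partial_def partial_mult)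

lemma has_partial_real_compose:
  assumes "has_partial i f f' x" "(h has_real_derivative h') (at (f x))"
  shows "has_partial i (\<lambda>x. h (f x)) (h' * f') x"
  using assms partial_real_compose[of f x h h' i] differentiable_real_compose[of f x h h']
  by (auto simp: has_partial_def)

lemma has_partial_exp:
  "has_partial i f f' x \<Longrightarrow> has_partial i (\<lambda>x. exp (f x)) (exp (f x) * f') x"
  by (rule has_partial_real_compose[OF _ DERIV_exp])

lemma has_partial_ln:
  "has_partial i f f' x \<Longrightarrow> 0 < f x \<Longrightarrow> has_partial i (\<lambda>x. ln (f x)) (1 / f x * f') x"
  by (rule has_partial_real_compose) (auto intro!: derivative_eq_intros)

lemma has_partial_divide:
  assumes "has_partial i f f' x" "has_partial i g g' x" "g x \<noteq> 0"
  shows "has_partial i (\<lambda>x. f x / g x) ((f' - f x * g' / g x) / g x) x"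
proof -
  have "has_partial i (\<lambda>x. inverse (g x)) (- (1 / (g x)\<^sup>2) * g') x"
    by (rule has_partial_real_compose[OF assms(2)])
      (use assms(3) in \<open>auto intro!: derivative_eq_intros simp: power2_eq_square field_simps\<close>)
  from has_partial_mult[OF assms(1) this] show ?thesis
    using assms(3) by (simp add: divide_inverse power2_eq_square algebra_simps)
qed

lemma has_partial_sum:
  "(\<And>k. k \<in> A \<Longrightarrow> has_partial i (f k) (f' k) x) \<Longrightarrow>
    has_partial i (\<lambda>x. \<Sum>k\<in>A. f k x) (\<Sum>k\<in>A. f' k) x"
  by (induction A rule: infinite_finite_induct) (auto intro: has_partial_add has_partial_const)

lemma has_partial_component: "has_partial i (\<lambda>x. x $ k) (if i = k then 1 else 0) x"
  by (simp add: has_partial_def smooth_funD(2)[OF smooth_fun_component UNIV_I])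

lemmas has_partial_intros = has_partial_const has_partial_add has_partial_diff has_partial_mult
  has_partial_exp has_partial_ln has_partial_divide has_partial_sum has_partial_component

lemma has_partial_eq: "has_partial i f d x \<Longrightarrow> d = e \<Longrightarrow> partial i f x = e"
  by (simp add: has_partial_def)

lemma has_partial_eqI: "has_partial i f d x \<Longrightarrow> d = e \<Longrightarrow> has_partial i f e x"
  by simp

lemma has_partial_linear_form:
  "has_partial i (\<lambda>x. w \<bullet> (x - y)) (w $ i) x"
proof -
  have "has_partial i (\<lambda>x. \<Sum>k\<in>UNIV. w $ k * (x $ k - y $ k))
    (\<Sum>k\<in>UNIV. 0 * (x $ k - y $ k) + w $ k * ((if i = k then 1 else 0) - 0)) x"
    by (intro has_partial_intros)
  then show ?thesis
    by (simp add: inner_vec_def if_distrib[where f = "\<lambda>c. _ * c"] cong: if_cong)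
qed

text \<open>Symmetry of the Hessian turns its row into the gradient of \<open>partial i f\<close>;
  the result contains an expression of the same kind and can be differentiated again by this
  rule.\<close>

lemma has_partial_taylor:
  assumes S: "open S" and f: "smooth_fun S f" and y: "y \<in> S"
  shows "has_partial i (\<lambda>y. grad f y \<bullet> (x - y)) (grad (partial i f) y \<bullet> (x - y) - partial i f y) y"
proof -
  have "has_partial i (\<lambda>y. \<Sum>k\<in>UNIV. partial k f y * (x $ k - y $ k))
    (\<Sum>k\<in>UNIV. partial i (partial k f) y * (x $ k - y $ k) + partial k f y * (0 - (if i = k then 1 else 0))) y"
    by (intro has_partial_intros has_partialI smooth_funD(2)[OF smooth_funD(1)[OF f] y])
  moreover have "(\<Sum>k\<in>UNIV. partial i (partial k f) y * (x $ k - y $ k) + partial k f y * (0 - (if i = k then 1 else 0)))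
     = grad (partial i f) y \<bullet> (x - y) - partial i f y"
    by (simp add: inner_vec_def partial_commute[OF S f y, of i] sum.distrib sum_negf sum_subtractf
      right_diff_distrib if_distrib[where f = "\<lambda>c. _ * c"] cong: if_cong)
  ultimately show ?thesis
    by (simp add: inner_vec_def)
qed

text \<open>\<open>s = 1\<close> is the concave and \<open>s = -1\<close> the convex case; the
  matrix in \<open>pd\<close> will be the metric.\<close>

locale exp_concave_or_convex =
  fixes \<alpha> s :: real and \<Omega> :: "(real^'n::finite) set" and \<phi> :: "real^'n \<Rightarrow> real"
  assumes \<alpha>: "0 < \<alpha>" and \<Omega>: "open \<Omega>" "convex \<Omega>" and smooth: "smooth_fun \<Omega> \<phi>"
    and s: "s * s = 1"
    and pd: "\<And>x. x \<in> \<Omega> \<Longrightarrow> pos_definite ((- s) *\<^sub>R (hessian \<phi> x + \<alpha> *\<^sub>R outer (grad \<phi> x) (grad \<phi> x)))"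
begin

text \<open>The Hessian of \<open>exp (\<alpha> * \<phi>)\<close> divided by
  \<open>\<alpha> * exp (\<alpha> * \<phi>)\<close>.\<close>

definition M :: "real^'n \<Rightarrow> real^'n^'n" where
  "M x = hessian \<phi> x + \<alpha> *\<^sub>R outer (grad \<phi> x) (grad \<phi> x)"

text \<open>The tangent plane of \<open>exp (\<alpha> * \<phi>)\<close> at \<open>y\<close>,
  evaluated at \<open>x\<close> and divided by the value at \<open>y\<close>.\<close>

definition N :: "real^'n \<Rightarrow> real^'n \<Rightarrow> real" where
  "N x y = 1 + \<alpha> * (grad \<phi> y \<bullet> (x - y))"

lemma M_nth: "M x $ i $ j = partial i (partial j \<phi>) x + \<alpha> * partial i \<phi> x * partial j \<phi> x"
  by (simp add: M_def hessian_def outer_def)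

lemma M_commute: "x \<in> \<Omega> \<Longrightarrow> M x $ i $ j = M x $ j $ i"
  using partial_commute[OF \<Omega>(1) smooth] by (simp add: M_nth mult_ac)

lemma inner_minus_s_M: "u \<bullet> (((- s) *\<^sub>R M x) *v v) = - s * (u \<bullet> (M x *v v))"
  by (simp only: scaleR_matrix_vector_assoc[symmetric] inner_scaleR_right)

lemma M_definite: "x \<in> \<Omega> \<Longrightarrow> v \<noteq> 0 \<Longrightarrow> s * (v \<bullet> (M x *v v)) < 0"
  using pd[of x] inner_minus_s_M[of v x v] by (force simp: pos_definite_def M_def[symmetric])

lemma M_inner_commute:
  assumes "x \<in> \<Omega>"
  shows "u \<bullet> (M x *v v) = v \<bullet> (M x *v u)"
proof -
  have "u \<bullet> (M x *v v) = (\<Sum>j\<in>UNIV. \<Sum>i\<in>UNIV. u $ i * v $ j * M x $ i $ j)"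
    using metric_inner_sum[of M x u v] by (subst sum.swap) (simp add: metric_inner_def)
  also have "\<dots> = v \<bullet> (M x *v u)"
    using metric_inner_sum[of M x v u] M_commute[OF assms]
    by (simp add: metric_inner_def mult.commute)
  finally show ?thesis .
qed

lemma diff_\<phi>: "x \<in> \<Omega> \<Longrightarrow> \<phi> differentiable (at x)"
  "x \<in> \<Omega> \<Longrightarrow> partial i \<phi> differentiable (at x)"
  "x \<in> \<Omega> \<Longrightarrow> partial i (partial j \<phi>) differentiable (at x)"
  using smooth smooth_funD by metis+

text \<open>\<open>s exp (\<alpha> \<phi>)\<close> is strictly concave, hence lies below its tangent planes.\<close>

lemma exp_less_tangent:
  assumes x: "x \<in> \<Omega>" and y: "y \<in> \<Omega>" and ne: "x \<noteq> y"
  shows "s * (exp (\<alpha> * (\<phi> x - \<phi> y)) - N x y) < 0"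
proof -
  define v where "v = x - y"
  define h where "h t = exp (\<alpha> * \<phi> (y + t *\<^sub>R v))" for t
  define p where "p t = grad \<phi> (y + t *\<^sub>R v) \<bullet> v" for t
  have in\<Omega>: "y + t *\<^sub>R v \<in> \<Omega>" if "0 \<le> t" "t \<le> 1" for t
    using convexD_alt[OF \<Omega>(2) y x, of t] that by (simp add: v_def algebra_simps)
  have dh: "(h has_real_derivative \<alpha> * h t * p t) (at t)" if "0 \<le> t" "t \<le> 1" for t
    unfolding h_def p_def
    by (auto intro!: derivative_eq_intros has_real_derivative_along_line diff_\<phi> in\<Omega> that)
  have cv: "smooth_field \<Omega> (\<lambda>x. v)"
    by (auto simp: smooth_field_def)
  have dp: "(p has_real_derivative v \<bullet> (hessian \<phi> (y + t *\<^sub>R v) *v v)) (at t)" if "0 \<le> t" "t \<le> 1" for t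
  proof -
    have "smooth_fun \<Omega> (\<lambda>x. grad \<phi> x \<bullet> v)"
      by (rule smooth_fun_inner[OF \<Omega>(1) smooth_field_grad[OF smooth] cv])
    from has_real_derivative_along_line[OF smooth_funD(2)[OF this in\<Omega>[OF that]]]
    have "(p has_real_derivative grad (\<lambda>x. grad \<phi> x \<bullet> v) (y + t *\<^sub>R v) \<bullet> v) (at t)"
      unfolding p_def .
    also have "grad (\<lambda>x. grad \<phi> x \<bullet> v) (y + t *\<^sub>R v) \<bullet> v = v \<bullet> (hessian \<phi> (y + t *\<^sub>R v) *v v)"
      using grad_inner_field[OF \<Omega>(1) smooth cv in\<Omega>[OF that], of v]
        metric_inner_sum[of "hessian \<phi>" "y + t *\<^sub>R v" v v]
      by (simp add: metric_inner_def hessian_def)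
    finally show ?thesis .
  qed
  define H where "H t = \<alpha> * h t * p t" for t
  \<comment> \<open>The square of \<open>p\<close> from the product rule completes the Hessian of
    \<phi> to \<open>M\<close>, whose definiteness fixes the sign of \<open>H'\<close>.\<close>
  have dH: "(H has_real_derivative \<alpha> * h t * (v \<bullet> (M (y + t *\<^sub>R v) *v v))) (at t)" if "0 \<le> t" "t \<le> 1" for t
  proof -
    have "v \<bullet> (M (y + t *\<^sub>R v) *v v) = v \<bullet> (hessian \<phi> (y + t *\<^sub>R v) *v v) + \<alpha> * p t * p t"
      by (simp add: M_def p_def outer_def matrix_vector_mult_def inner_vec_def sum_distrib_left
        sum_distrib_right distrib_left distrib_right sum.distrib mult_ac)
    then show ?thesis
      unfolding H_def
      by (auto intro!: derivative_eq_intros dh dp that simp: algebra_simps)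
  qed
  have v: "v \<noteq> 0" using ne by (simp add: v_def)
  \<comment> \<open>The increment of \<open>h\<close> is its slope at \<tau>. The slope at 0 gives
    the tangent, as \<open>h 0 + H 0 = h 0 * N x y\<close>.\<close>
  obtain \<tau> where \<tau>: "0 < \<tau>" "\<tau> < 1" "h 1 - h 0 = (1 - 0) * H \<tau>"
    using MVT2[of 0 1 h H] dh by (auto simp: H_def)
  have "s * H \<tau> < s * H 0"
  proof (rule DERIV_neg_imp_decreasing[OF \<tau>(1)])
    fix t assume t: "0 \<le> t" "t \<le> \<tau>"
    have "((\<lambda>t. s * H t) has_real_derivative s * (\<alpha> * h t * (v \<bullet> (M (y + t *\<^sub>R v) *v v)))) (at t)"
      using dH[of t] t \<tau> by (intro DERIV_cmult) auto
    moreover have "s * (\<alpha> * h t * (v \<bullet> (M (y + t *\<^sub>R v) *v v))) < 0"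
    proof -
      have "\<alpha> * h t * (s * (v \<bullet> (M (y + t *\<^sub>R v) *v v))) < 0"
        using M_definite[OF in\<Omega> v, of t] t \<tau> \<alpha> by (intro mult_pos_neg[of "\<alpha> * h t"]) (auto simp: h_def)
      then show ?thesis by (simp add: mult_ac)
    qed
    ultimately show "\<exists>d. ((\<lambda>t. s * H t) has_real_derivative d) (at t) \<and> d < 0" by blast
  qed
  then have "s * (h 1 - h 0 - H 0) < 0"
    using \<tau>(3) by (simp add: right_diff_distrib)
  moreover have "h 1 = h 0 * exp (\<alpha> * (\<phi> x - \<phi> y))"
    by (simp add: h_def v_def exp_add[symmetric] algebra_simps)
  ultimately have "h 0 * (s * (exp (\<alpha> * (\<phi> x - \<phi> y)) - N x y)) < 0"
    by (simp add: H_def N_def p_def v_def algebra_simps)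
  moreover have "0 < h 0" by (simp add: h_def)
  ultimately show ?thesis
    by (simp add: mult_less_0_iff)
qed

end

text \<open>\<open>N_pos\<close> makes the logarithm meaningful; \<open>W_pos\<close> makes the last
  component of the dual immersion positive.\<close>

locale L_divergence = exp_concave_or_convex \<alpha> s \<Omega> \<phi>
  for \<alpha> s :: real and \<Omega> :: "(real^'n::finite) set" and \<phi> :: "real^'n \<Rightarrow> real" +
  assumes N_pos: "\<And>x y. x \<in> \<Omega> \<Longrightarrow> y \<in> \<Omega> \<Longrightarrow> 0 < 1 + \<alpha> * (grad \<phi> y \<bullet> (x - y))"
    and W_pos: "\<And>x. x \<in> \<Omega> \<Longrightarrow> 0 < 1 - \<alpha> * (grad \<phi> x \<bullet> x)"
begin

definition D :: "'n divergence" where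
  "D x y = s * (1 / \<alpha> * ln (N x y) - (\<phi> x - \<phi> y))"

lemma N_pos': "x \<in> \<Omega> \<Longrightarrow> y \<in> \<Omega> \<Longrightarrow> 0 < N x y"
  using N_pos by (simp add: N_def)

lemma N_ne: "x \<in> \<Omega> \<Longrightarrow> y \<in> \<Omega> \<Longrightarrow> N x y \<noteq> 0"
  using N_pos' by force

lemma N_self [simp]: "N x x = 1"
  by (simp add: N_def)

text \<open>The derivative of \<open>N x y\<close> in the \<open>k\<close>-th coordinate of
  \<open>y\<close>, divided by \<alpha>.\<close>

definition B :: "'n \<Rightarrow> real^'n \<Rightarrow> real^'n \<Rightarrow> real" where
  "B k x y = grad (partial k \<phi>) y \<bullet> (x - y) - partial k \<phi> y"

lemma B_self [simp]: "B k x x = - partial k \<phi> x"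
  by (simp add: B_def)

lemma has_partial_N_fst: "has_partial i (\<lambda>x. N x y) (\<alpha> * partial i \<phi> y) x"
  unfolding N_def
  by (rule has_partial_eqI, (rule has_partial_intros has_partial_linear_form)+) simp

lemma has_partial_N_snd: "y \<in> \<Omega> \<Longrightarrow> has_partial i (N x) (\<alpha> * B i x y) y"
  unfolding N_def[abs_def] B_def
  using has_partial_add[OF has_partial_const has_partial_mult[OF has_partial_const
    has_partial_taylor[OF \<Omega>(1) smooth]], of y i]
  by simp

lemma has_partial_B_fst: "has_partial i (\<lambda>x. B k x y) (partial i (partial k \<phi>) y) x"
  unfolding B_def
  by (rule has_partial_eqI, (rule has_partial_intros has_partial_linear_form)+) simp

lemma has_partial_B_snd:
  assumes "y \<in> \<Omega>"
  shows "has_partial i (B k x)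
    (grad (partial i (partial k \<phi>)) y \<bullet> (x - y) - 2 * partial i (partial k \<phi>) y) y"
  unfolding B_def[abs_def]
  using has_partial_diff[OF has_partial_taylor[OF \<Omega>(1) smooth_funD(1)[OF smooth] assms]
    has_partialI[OF diff_\<phi>(2)[OF assms]], of i k x k]
  by simp

lemmas has_partial_\<phi> = has_partialI[OF diff_\<phi>(1)] has_partialI[OF diff_\<phi>(2)] has_partialI[OF diff_\<phi>(3)]

lemma partial_snd_D:
  assumes "x \<in> \<Omega>" "y \<in> \<Omega>"
  shows "partial_snd k D x y = s * (B k x y / N x y + partial k \<phi> y)"
  unfolding partial_snd_def D_def
  by (rule has_partial_eq, (rule has_partial_intros has_partial_N_snd has_partial_\<phi> N_pos' assms)+)
    (use \<alpha> in simp)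

lemma partial_fst_snd_D:
  assumes "x \<in> \<Omega>" "y \<in> \<Omega>"
  shows "partial_fst j (partial_snd k D) x y =
    s * (partial j (partial k \<phi>) y / N x y - B k x y * \<alpha> * partial j \<phi> y / (N x y * N x y))"
proof -
  have "partial_fst j (partial_snd k D) x y = partial j (\<lambda>x. s * (B k x y / N x y + partial k \<phi> y)) x"
    unfolding partial_fst_def[of j] by (rule partial_cong[OF \<Omega>(1) assms(1)]) (simp add: partial_snd_D assms(2))
  also have "\<dots> = s * (partial j (partial k \<phi>) y / N x y - B k x y * \<alpha> * partial j \<phi> y / (N x y * N x y))"
    by (rule has_partial_eq, (rule has_partial_intros has_partial_N_fst has_partial_B_fst no_zero_divisors N_ne assms)+)
      (use N_pos'[OF assms] in \<open>auto simp: field_simps\<close>)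
  finally show ?thesis .
qed

text \<open>The diagonal is entered only after the last differentiation. There \<open>N\<close> is 1
  and \<open>B k\<close> is \<open>- partial k \<phi>\<close>, so that the derivatives of \<phi>
  pair up to entries of \<open>M\<close>.\<close>

lemma partial_fst_fst_snd_D:
  assumes "x \<in> \<Omega>"
  shows "partial_fst i (partial_fst j (partial_snd k D)) x x =
    - s * \<alpha> * (partial i \<phi> x * M x $ j $ k + partial j \<phi> x * M x $ i $ k)"
proof -
  have "partial_fst i (partial_fst j (partial_snd k D)) x x = partial i (\<lambda>z.
    s * (partial j (partial k \<phi>) x / N z x - B k z x * \<alpha> * partial j \<phi> x / (N z x * N z x))) x"
    unfolding partial_fst_def[of i] by (rule partial_cong[OF \<Omega>(1) assms]) (simp add: partial_fst_snd_D assms)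
  also have "\<dots> = - s * \<alpha> * (partial i \<phi> x * M x $ j $ k + partial j \<phi> x * M x $ i $ k)"
    by (rule has_partial_eq, (rule has_partial_intros has_partial_N_fst has_partial_B_fst no_zero_divisors N_ne assms)+)
      (auto simp: M_nth algebra_simps)
  finally show ?thesis .
qed

lemma partial_fst_D:
  assumes "x \<in> \<Omega>" "y \<in> \<Omega>"
  shows "partial_fst k D x y = s * (partial k \<phi> y / N x y - partial k \<phi> x)"
  unfolding partial_fst_def D_def
  by (rule has_partial_eq, (rule has_partial_intros has_partial_N_fst has_partial_\<phi> N_pos' assms)+)
    (use \<alpha> in simp)

lemma partial_snd_fst_D:
  assumes "x \<in> \<Omega>" "y \<in> \<Omega>"
  shows "partial_snd j (partial_fst k D) x y =
    s * (partial j (partial k \<phi>) y / N x y - partial k \<phi> y * \<alpha> * B j x y / (N x y * N x y))"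
proof -
  have "partial_snd j (partial_fst k D) x y = partial j (\<lambda>y. s * (partial k \<phi> y / N x y - partial k \<phi> x)) y"
    unfolding partial_snd_def[of j] by (rule partial_cong[OF \<Omega>(1) assms(2)]) (simp add: partial_fst_D assms(1))
  also have "\<dots> = s * (partial j (partial k \<phi>) y / N x y - partial k \<phi> y * \<alpha> * B j x y / (N x y * N x y))"
    by (rule has_partial_eq, (rule has_partial_intros has_partial_N_snd has_partial_\<phi> no_zero_divisors N_ne assms)+)
      (use N_pos'[OF assms] in \<open>auto simp: field_simps\<close>)
  finally show ?thesis .
qed

text \<open>The dual Christoffel symbols lowered by \<open>M\<close>. The first two terms are
  \<open>exp (- \<alpha> * \<phi> x)\<close> times the second derivatives of \<open>F k\<close>; the
  last is the transversal part of the Gauss equation, moved to the other side.\<close>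

definition b :: "real^'n \<Rightarrow> 'n \<Rightarrow> 'n \<Rightarrow> real^'n" where
  "b x i j = (\<chi> k. partial i (\<lambda>x. M x $ j $ k) x + \<alpha> * partial i \<phi> x * M x $ j $ k
    + \<alpha> * M x $ i $ j * partial k \<phi> x)"

lemma partial_M:
  assumes "x \<in> \<Omega>"
  shows "partial i (\<lambda>x. M x $ j $ k) x = partial i (partial j (partial k \<phi>)) x
    + \<alpha> * (partial i (partial j \<phi>) x * partial k \<phi> x + partial j \<phi> x * partial i (partial k \<phi>) x)"
  unfolding M_nth
  by (rule has_partial_eq, (rule has_partial_intros has_partial_\<phi> assms)+) (simp add: algebra_simps)

lemma b_nth:
  assumes "x \<in> \<Omega>"
  shows "b x i j $ k = partial i (partial j (partial k \<phi>)) x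
    + \<alpha> * (partial i (partial j \<phi>) x * partial k \<phi> x + partial j \<phi> x * partial i (partial k \<phi>) x)
    + \<alpha> * partial i \<phi> x * M x $ j $ k + \<alpha> * M x $ i $ j * partial k \<phi> x"
  by (simp add: b_def partial_M[OF assms])

lemma partial_snd_snd_fst_D:
  assumes "x \<in> \<Omega>"
  shows "partial_snd i (partial_snd j (partial_fst k D)) x x = s * b x i j $ k"
proof -
  have "partial_snd i (partial_snd j (partial_fst k D)) x x = partial i (\<lambda>y.
    s * (partial j (partial k \<phi>) y / N x y - partial k \<phi> y * \<alpha> * B j x y / (N x y * N x y))) x"
    unfolding partial_snd_def[of i] by (rule partial_cong[OF \<Omega>(1) assms]) (simp add: partial_snd_fst_D assms)
  also have "\<dots> = s * b x i j $ k"
    by (rule has_partial_eq, (rule has_partial_intros has_partial_N_snd has_partial_B_snd has_partial_\<phi> no_zero_divisors N_ne assms)+)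
      (auto simp: b_nth[OF assms] M_nth algebra_simps)
  finally show ?thesis .
qed

lemma div_metric_D:
  assumes "x \<in> \<Omega>"
  shows "div_metric D x = (- s) *\<^sub>R M x"
  by (simp add: div_metric_def vec_eq_iff partial_fst_snd_D assms M_nth algebra_simps)

lemma metric_inner_D: "x \<in> \<Omega> \<Longrightarrow> metric_inner (div_metric D) x u v = - s * (u \<bullet> (M x *v v))"
  by (simp only: metric_inner_def div_metric_D inner_minus_s_M)

lemma s_ne: "s \<noteq> 0"
  using s by auto

lemma M_inj: "x \<in> \<Omega> \<Longrightarrow> M x *v v = 0 \<Longrightarrow> v = 0"
  using M_definite[of x v] by fastforce

lemma M_invertible: "x \<in> \<Omega> \<Longrightarrow> invertible (M x)"
  using M_inj[of x] invertible_left_inverse matrix_left_invertible_ker by metis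

text \<open>The nonzero factor \<open>- s\<close> cancels from both sides and definiteness of
  \<open>M\<close> makes the solution unique, so the definite description denotes it.\<close>

lemma the_metric_dual:
  assumes x: "x \<in> \<Omega>" and w: "M x *v w = c"
  shows "(THE v. \<forall>k. metric_inner (div_metric D) x v (axis k 1) = - s * c $ k) = w"
proof -
  have eq: "(\<forall>k. metric_inner (div_metric D) x v (axis k 1) = - s * c $ k) \<longleftrightarrow> M x *v v = c" for v
    using s_ne x by (simp add: metric_inner_D M_inner_commute[OF x, of v] inner_axis' vec_eq_iff)
  show ?thesis
    unfolding eq
  proof (rule the_equality[of "\<lambda>v. M x *v v = c", OF w])
    fix v assume "M x *v v = c"
    then have "M x *v (v - w) = 0" by (simp add: w matrix_vector_mult_diff_distrib)
    then show "v = w" using M_inj[OF x] by force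
  qed
qed

text \<open>The lowered symbols combine columns \<open>i\<close> and \<open>j\<close> of
  \<open>M x\<close>, so raising the index leaves a projective change of the Euclidean connection,
  by the 1-form \<open>- \<alpha> d\<phi>\<close>.\<close>

lemma primal_connection_D:
  assumes "x \<in> \<Omega>"
  shows "primal_connection D x i j = (- \<alpha>) *\<^sub>R (partial i \<phi> x *\<^sub>R axis j 1 + partial j \<phi> x *\<^sub>R axis i 1)"
proof -
  have D: "- partial_fst i (partial_fst j (partial_snd k D)) x x =
    - s * (\<chi> k. - \<alpha> * (partial i \<phi> x * M x $ j $ k + partial j \<phi> x * M x $ i $ k)) $ k" for k
    by (simp add: partial_fst_fst_snd_D[OF assms])
  have M: "M x *v ((- \<alpha>) *\<^sub>R (partial i \<phi> x *\<^sub>R axis j 1 + partial j \<phi> x *\<^sub>R axis i 1)) =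
    (\<chi> k. - \<alpha> * (partial i \<phi> x * M x $ j $ k + partial j \<phi> x * M x $ i $ k))"
    unfolding matrix_vector_mult_scaleR matrix_vector_right_distrib matrix_vector_mult_basis
    using M_commute[OF assms] by (simp add: vec_eq_iff column_def)
  show ?thesis
    unfolding primal_connection_def D by (rule the_metric_dual[OF assms M])
qed

lemma M_dual_connection_D:
  assumes "x \<in> \<Omega>"
  shows "M x *v dual_connection D x i j = b x i j"
proof -
  have inv: "M x *v (matrix_inv (M x) *v b x i j) = b x i j"
    using M_invertible[OF assms] by (simp add: matrix_vector_mul_assoc matrix_mult_matrix_inv)
  have D: "- partial_snd i (partial_snd j (partial_fst k D)) x x = - s * b x i j $ k" for k
    by (simp add: partial_snd_snd_fst_D[OF assms])
  have "dual_connection D x i j = matrix_inv (M x) *v b x i j"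
    unfolding dual_connection_def D by (rule the_metric_dual[OF assms inv])
  then show ?thesis using inv by simp
qed

end

section \<open>The primal and the dual immersion\<close>

context L_divergence
begin

lemma smooth_M: "smooth_fun \<Omega> (\<lambda>x. M x $ i $ j)"
  unfolding M_nth by (intro smooth_fun_intros \<Omega>(1) smooth)

lemma smooth_h: "smooth_fun \<Omega> (\<lambda>x. ((- \<alpha>) *\<^sub>R M x) $ i $ j)"
  using smooth_fun_cmult[OF \<Omega>(1) smooth_M, of "- \<alpha>" i j] by simp

lemma smooth_primal: "smooth_connection \<Omega> (primal_connection D)"
  unfolding smooth_connection_def smooth_field_def
proof (intro allI)
  fix i j k
  have "smooth_fun \<Omega> (\<lambda>x. ((- \<alpha>) *\<^sub>R (partial i \<phi> x *\<^sub>R axis j 1 + partial j \<phi> x *\<^sub>R axis i 1)) $ k)"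
    unfolding vector_scaleR_component vector_add_component real_scaleR_def
    by (intro smooth_fun_intros \<Omega>(1) smooth)
  then show "smooth_fun \<Omega> (\<lambda>x. primal_connection D x i j $ k)"
    by (rule smooth_fun_cong[OF \<Omega>(1)]) (simp add: primal_connection_D)
qed

lemma smooth_dual: "smooth_connection \<Omega> (dual_connection D)"
  unfolding smooth_connection_def
proof (intro allI, rule smooth_field_solve[OF \<Omega>(1) smooth_M _ _ M_dual_connection_D])
  show "smooth_field \<Omega> (\<lambda>x. b x i j)" for i j
    unfolding smooth_field_def b_def vec_lambda_beta
    by (intro allI smooth_fun_intros \<Omega>(1) smooth smooth_M)
  show "det (M x) \<noteq> 0" if "x \<in> \<Omega>" for x
    using M_invertible[OF that] by (simp add: invertible_det_nz)
qed

definition E :: "real^'n \<Rightarrow> real" where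
  "E x = exp (- \<alpha> * \<phi> x)"

lemma smooth_E: "smooth_fun \<Omega> E"
  unfolding E_def[abs_def] by (intro smooth_fun_intros \<Omega>(1) smooth)

lemma partial_E: "x \<in> \<Omega> \<Longrightarrow> partial i E x = - \<alpha> * partial i \<phi> x * E x"
  unfolding E_def[abs_def]
  by (rule has_partial_eq, (rule has_partial_intros has_partial_\<phi> | assumption)+) simp

lemma partial_partial_E:
  assumes "x \<in> \<Omega>"
  shows "partial i (partial j E) x =
    (- \<alpha> * partial i (partial j \<phi>) x + \<alpha> * \<alpha> * partial i \<phi> x * partial j \<phi> x) * E x"
proof -
  have "partial i (partial j E) x = partial i (\<lambda>x. - \<alpha> * partial j \<phi> x * E x) x"
    by (rule partial_cong[OF \<Omega>(1) assms partial_E])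
  also have "\<dots> = (- \<alpha> * partial i (partial j \<phi>) x + \<alpha> * \<alpha> * partial i \<phi> x * partial j \<phi> x) * E x"
    by (rule has_partial_eq, (rule has_partial_intros has_partial_\<phi> assms
        has_partial_eqI[OF has_partialI[OF smooth_funD(2)[OF smooth_E assms]] partial_E[OF assms]])+)
      (simp add: algebra_simps)
  finally show ?thesis .
qed

sublocale primal: centroaffine_immersion \<Omega> "primal_connection D" "\<lambda>x. (- \<alpha>) *\<^sub>R M x"
  "\<lambda>k x. x $ k * E x" E
proof
  have E': "E differentiable (at x)" "(\<lambda>x. x $ k) differentiable (at x)" if "x \<in> \<Omega>" for x k
    using smooth_funD(2)[OF smooth_E that] smooth_funD(2)[OF smooth_fun_component UNIV_I] by auto
  have gradE: "grad E x \<bullet> primal_connection D x i j = 2 * \<alpha> * \<alpha> * partial i \<phi> x * partial j \<phi> x * E x"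
    if "x \<in> \<Omega>" for x i j
    by (simp add: primal_connection_D[OF that] inner_add_right partial_E[OF that])
  show "open \<Omega>" by (rule \<Omega>)
  show "smooth_connection \<Omega> (primal_connection D)" by (rule smooth_primal)
  show "primal_connection D x i j = primal_connection D x j i" if "x \<in> \<Omega>" for x i j
    by (simp add: primal_connection_D[OF that] add.commute)
  show "smooth_fun \<Omega> (\<lambda>x. ((- \<alpha>) *\<^sub>R M x) $ i $ j)" for i j
    by (rule smooth_h)
  show gE: "gauss_eq \<Omega> (primal_connection D) (\<lambda>x. (- \<alpha>) *\<^sub>R M x) E"
    using smooth_E by (auto simp: gauss_eq_def partial_partial_E gradE M_nth algebra_simps)
  show "0 < E x" for x by (simp add: E_def)
  have grad: "grad (\<lambda>x. x $ k * E x) x \<bullet> v = v $ k * E x + x $ k * (grad E x \<bullet> v)"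
    if "x \<in> \<Omega>" for x v k
    using E'[OF that] by (simp add: grad_mult inner_add_left)
      (simp add: inner_vec_def grad_def if_distrib[where f = "\<lambda>c. c * _"] cong: if_cong)
  show "gauss_eq \<Omega> (primal_connection D) (\<lambda>x. (- \<alpha>) *\<^sub>R M x) (\<lambda>x. x $ k * E x)" for k
    unfolding gauss_eq_def
  proof (intro conjI ballI allI)
    show "smooth_fun \<Omega> (\<lambda>x. x $ k * E x)"
      by (intro smooth_fun_intros \<Omega>(1) smooth_E)
    fix x i j assume x: "x \<in> \<Omega>"
    have e: "partial i (partial j E) x =
      grad E x \<bullet> primal_connection D x i j + ((- \<alpha>) *\<^sub>R M x) $ i $ j * E x"
      using gE x by (simp add: gauss_eq_def)
    have "x $ k * partial i (partial j E) x =
      x $ k * (grad E x \<bullet> primal_connection D x i j) + ((- \<alpha>) *\<^sub>R M x) $ i $ j * (x $ k * E x)"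
      unfolding e by (simp add: algebra_simps)
    \<comment> \<open>The mixed terms of the product rule for \<open>x $ k * E x\<close> are exactly
      the \<open>k\<close>-th Christoffel component times \<open>E\<close>.\<close>
    moreover have "primal_connection D x i j $ k * E x =
      (if j = k then 1 else 0) * partial i E x + (if i = k then 1 else 0) * partial j E x"
      by (auto simp: primal_connection_D[OF x] partial_E[OF x] axis_def)
    ultimately show "partial i (partial j (\<lambda>x. x $ k * E x)) x =
      grad (\<lambda>x. x $ k * E x) x \<bullet> primal_connection D x i j + ((- \<alpha>) *\<^sub>R M x) $ i $ j * (x $ k * E x)"
      by (simp add: partial_partial_mult[OF \<Omega>(1) smooth_fun_component smooth_E x] grad[OF x] algebra_simps)
  qed
  fix x v C assume x: "x \<in> \<Omega>" and *: "\<And>k. grad (\<lambda>x. x $ k * E x) x \<bullet> v + C * (x $ k * E x) = 0"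
    "grad E x \<bullet> v + C * E x = 0"
  \<comment> \<open>Subtracting \<open>x $ k\<close> times the equation of the last component leaves
    \<open>v $ k * E x = 0\<close>.\<close>
  have "v $ k * E x + x $ k * (grad E x \<bullet> v + C * E x) = 0" for k
    using *(1)[of k] by (simp add: grad[OF x] algebra_simps)
  then have "v $ k = 0" for k
    using *(2) by (simp add: E_def)
  then show "v = 0" by (simp add: vec_eq_iff)
qed

text \<open>The tangent hyperplane of the graph of \<open>exp (\<alpha> \<phi>)\<close> as a covector; its projective class is the
  dual coordinate.\<close>

definition F :: "'n \<Rightarrow> real^'n \<Rightarrow> real" where
  "F k x = exp (\<alpha> * \<phi> x) * partial k \<phi> x"

text \<open>The height of the tangent hyperplane over the origin, written through \<open>F k\<close>
  so that its derivatives reduce to those of \<open>F\<close>.\<close>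

definition F\<^sub>0 :: "real^'n \<Rightarrow> real" where
  "F\<^sub>0 x = exp (\<alpha> * \<phi> x) - \<alpha> * (\<Sum>k\<in>UNIV. F k x * x $ k)"

lemma F\<^sub>0_eq: "F\<^sub>0 x = exp (\<alpha> * \<phi> x) * (1 - \<alpha> * (grad \<phi> x \<bullet> x))"
  by (simp add: F\<^sub>0_def F_def inner_vec_def sum_distrib_left right_diff_distrib mult_ac)

lemma smooth_F: "smooth_fun \<Omega> (F k)"
  unfolding F_def[abs_def] by (intro smooth_fun_intros \<Omega>(1) smooth)

lemma smooth_F\<^sub>0: "smooth_fun \<Omega> F\<^sub>0"
  unfolding F\<^sub>0_def[abs_def] by (intro smooth_fun_intros \<Omega>(1) smooth smooth_F)

lemma partial_F:
  assumes "x \<in> \<Omega>"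
  shows "partial j (F k) x = exp (\<alpha> * \<phi> x) * M x $ j $ k"
  unfolding F_def[abs_def]
  by (rule has_partial_eq, (rule has_partial_intros has_partial_\<phi> assms)+)
    (simp add: M_nth algebra_simps)

lemma grad_F:
  assumes "x \<in> \<Omega>"
  shows "grad (F k) x \<bullet> v = exp (\<alpha> * \<phi> x) * (M x *v v) $ k"
  using M_commute[OF assms]
  by (simp add: grad_sum_axis partial_F[OF assms] matrix_vector_mult_def sum_distrib_left mult_ac)

text \<open>The derivative of the exponential, \<open>\<alpha> * F j x\<close>, cancels the term
  from differentiating \<open>x $ j\<close>. In terms of the pairing, the differential of the dual
  immersion annihilates \<open>(x, 1)\<close>.\<close>

lemma partial_F\<^sub>0:
  assumes "x \<in> \<Omega>"
  shows "partial j F\<^sub>0 x = - \<alpha> * (\<Sum>k\<in>UNIV. partial j (F k) x * x $ k)"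
  unfolding F\<^sub>0_def[abs_def]
  by (rule has_partial_eq, (rule has_partial_intros has_partial_\<phi> assms
      has_partialI[OF smooth_funD(2)[OF smooth_F assms]])+)
    (simp add: sum.distrib F_def if_distrib[where f = "\<lambda>c. _ * c"] algebra_simps cong: if_cong)

lemma grad_F\<^sub>0:
  assumes "x \<in> \<Omega>"
  shows "grad F\<^sub>0 x \<bullet> v = - \<alpha> * (\<Sum>k\<in>UNIV. (grad (F k) x \<bullet> v) * x $ k)"
proof -
  have "(\<Sum>i\<in>UNIV. \<Sum>k\<in>UNIV. v $ i * partial i (F k) x * x $ k) =
    (\<Sum>k\<in>UNIV. \<Sum>i\<in>UNIV. v $ i * partial i (F k) x * x $ k)"
    by (rule sum.swap)
  moreover have "grad F\<^sub>0 x \<bullet> v = - \<alpha> * (\<Sum>i\<in>UNIV. \<Sum>k\<in>UNIV. v $ i * partial i (F k) x * x $ k)"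
    by (simp add: grad_sum_axis partial_F\<^sub>0[OF assms] sum_distrib_left sum_negf mult_ac)
  moreover have "(\<Sum>k\<in>UNIV. (grad (F k) x \<bullet> v) * x $ k) =
    (\<Sum>k\<in>UNIV. \<Sum>i\<in>UNIV. v $ i * partial i (F k) x * x $ k)"
    by (simp add: grad_sum_axis sum_distrib_right)
  ultimately show ?thesis by simp
qed

text \<open>By \<open>grad_F\<close> the differential contains \<open>M\<close> as a factor; applied
  to the dual connection it meets \<open>M_dual_connection_D\<close>, and the inverse of
  \<open>M\<close> drops out.\<close>

lemma gauss_F: "gauss_eq \<Omega> (dual_connection D) (\<lambda>x. (- \<alpha>) *\<^sub>R M x) (F k)"
  unfolding gauss_eq_def
proof (intro conjI ballI allI smooth_F)
  fix x i j assume x: "x \<in> \<Omega>"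
  have "partial i (partial j (F k)) x = partial i (\<lambda>x. exp (\<alpha> * \<phi> x) * M x $ j $ k) x"
    by (rule partial_cong[OF \<Omega>(1) x partial_F])
  also have "\<dots> = exp (\<alpha> * \<phi> x) * (partial i (\<lambda>x. M x $ j $ k) x + \<alpha> * partial i \<phi> x * M x $ j $ k)"
    by (rule has_partial_eq, (rule has_partial_intros has_partial_\<phi> x
        has_partialI[OF smooth_funD(2)[OF smooth_M x]])+)
      (simp add: algebra_simps)
  also have "\<dots> = grad (F k) x \<bullet> dual_connection D x i j + ((- \<alpha>) *\<^sub>R M x) $ i $ j * F k x"
    by (simp add: grad_F[OF x] M_dual_connection_D[OF x] b_def F_def algebra_simps)
  finally show "partial i (partial j (F k)) x =
    grad (F k) x \<bullet> dual_connection D x i j + ((- \<alpha>) *\<^sub>R M x) $ i $ j * F k x" .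
qed

text \<open>Differentiating \<open>partial_F\<^sub>0\<close> once more adds
  \<open>- \<alpha> * partial j (F i) x\<close>. With the transversal terms of all
  \<open>F k\<close> this gives the multiple of \<open>F\<^sub>0\<close>, since
  \<open>exp (\<alpha> * \<phi> x)\<close> is \<open>F\<^sub>0 x\<close> plus \<alpha> times the sum
  of the \<open>F k x * x $ k\<close>.\<close>

lemma gauss_F\<^sub>0: "gauss_eq \<Omega> (dual_connection D) (\<lambda>x. (- \<alpha>) *\<^sub>R M x) F\<^sub>0"
  unfolding gauss_eq_def
proof (intro conjI ballI allI smooth_F\<^sub>0)
  fix x i j assume x: "x \<in> \<Omega>"
  have "partial i (partial j F\<^sub>0) x = partial i (\<lambda>x. - \<alpha> * (\<Sum>k\<in>UNIV. partial j (F k) x * x $ k)) x"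
    by (rule partial_cong[OF \<Omega>(1) x partial_F\<^sub>0])
  also have "\<dots> = - \<alpha> * (\<Sum>k\<in>UNIV. partial i (partial j (F k)) x * x $ k) - \<alpha> * partial j (F i) x"
    by (rule has_partial_eq, (rule has_partial_intros
        has_partialI[OF smooth_funD(2)[OF smooth_funD(1)[OF smooth_F] x]])+)
      (simp add: sum.distrib if_distrib[where f = "\<lambda>c. c * _"] algebra_simps cong: if_cong)
  also have "(\<Sum>k\<in>UNIV. partial i (partial j (F k)) x * x $ k) =
    (\<Sum>k\<in>UNIV. (grad (F k) x \<bullet> dual_connection D x i j) * x $ k) - \<alpha> * M x $ i $ j * (\<Sum>k\<in>UNIV. F k x * x $ k)"
  proof -
    have "partial i (partial j (F k)) x = (grad (F k) x \<bullet> dual_connection D x i j) - \<alpha> * M x $ i $ j * F k x" for k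
      using gauss_F[of k] x by (simp add: gauss_eq_def)
    then show ?thesis
      by (simp add: left_diff_distrib sum_subtractf sum_distrib_left mult.assoc)
  qed
  also have "- \<alpha> * (\<dots>) - \<alpha> * partial j (F i) x =
    grad F\<^sub>0 x \<bullet> dual_connection D x i j + ((- \<alpha>) *\<^sub>R M x) $ i $ j * F\<^sub>0 x"
    using M_commute[OF x, of j i]
    by (simp add: grad_F\<^sub>0[OF x] partial_F[OF x] F\<^sub>0_def algebra_simps)
  finally show "partial i (partial j F\<^sub>0) x =
    grad F\<^sub>0 x \<bullet> dual_connection D x i j + ((- \<alpha>) *\<^sub>R M x) $ i $ j * F\<^sub>0 x" .
qed

sublocale dual: centroaffine_immersion \<Omega> "dual_connection D" "\<lambda>x. (- \<alpha>) *\<^sub>R M x" F F\<^sub>0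
proof
  show "open \<Omega>" by (rule \<Omega>)
  show "smooth_connection \<Omega> (dual_connection D)" by (rule smooth_dual)
  show "dual_connection D x i j = dual_connection D x j i" if x: "x \<in> \<Omega>" for x i j
  proof -
    have "b x i j = b x j i"
      using M_commute[OF x, of i j] partial_commute[OF \<Omega>(1) smooth_funD(1)[OF smooth] x]
        partial_commute[OF \<Omega>(1) smooth x, of i j]
      by (simp add: vec_eq_iff b_nth[OF x] M_nth algebra_simps)
    then have "M x *v (dual_connection D x i j - dual_connection D x j i) = 0"
      by (simp add: M_dual_connection_D[OF x] matrix_vector_mult_diff_distrib)
    then show ?thesis using M_inj[OF x] by force
  qed
  show "smooth_fun \<Omega> (\<lambda>x. ((- \<alpha>) *\<^sub>R M x) $ i $ j)" for i j
    by (rule smooth_h)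
  show "gauss_eq \<Omega> (dual_connection D) (\<lambda>x. (- \<alpha>) *\<^sub>R M x) (F k)" for k by (rule gauss_F)
  show "gauss_eq \<Omega> (dual_connection D) (\<lambda>x. (- \<alpha>) *\<^sub>R M x) F\<^sub>0" by (rule gauss_F\<^sub>0)
  show "0 < F\<^sub>0 x" if "x \<in> \<Omega>" for x
    using W_pos[OF that] by (simp add: F\<^sub>0_eq)
  fix x v C assume x: "x \<in> \<Omega>" and *: "\<And>k. grad (F k) x \<bullet> v + C * F k x = 0"
    "grad F\<^sub>0 x \<bullet> v + C * F\<^sub>0 x = 0"
  have "grad (F k) x \<bullet> v = - C * F k x" for k
    using *(1)[of k] by simp
  \<comment> \<open>In the pairing with \<open>(x, 1)\<close> the differential contributes nothing
    and the position vector gives \<open>exp (\<alpha> * \<phi> x)\<close>, so \<open>C\<close>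
    times the latter is zero.\<close>
  then have "grad F\<^sub>0 x \<bullet> v = C * (exp (\<alpha> * \<phi> x) - F\<^sub>0 x)"
    by (simp add: grad_F\<^sub>0[OF x] F\<^sub>0_def sum_distrib_left sum_negf mult_ac)
  then have "C = 0" using *(2) by (simp add: algebra_simps)
  then have "M x *v v = 0" using *(1) by (simp add: grad_F[OF x] vec_eq_iff)
  then show "v = 0" by (rule M_inj[OF x])
qed

text \<open>As \<open>s * s = 1\<close>, the factor \<open>- \<alpha>\<close> is
  \<open>s * \<alpha>\<close> times the factor \<open>- s\<close> of the metric; this fixes the sign
  of the curvature.\<close>

lemma metric_inner_h:
  "x \<in> \<Omega> \<Longrightarrow> metric_inner (\<lambda>x. (- \<alpha>) *\<^sub>R M x) x u v = s * \<alpha> * metric_inner (div_metric D) x u v"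
  unfolding metric_inner_D
  using s by (simp add: metric_inner_def scaleR_matrix_vector_assoc[symmetric] mult_ac
    flip: scaleR_minus_left)

lemma constant_sectional_curvature:
  "constant_sectional_curvature \<Omega> (div_metric D) (primal_connection D) (- s * \<alpha>)"
  "constant_sectional_curvature \<Omega> (div_metric D) (dual_connection D) (- s * \<alpha>)"
  unfolding constant_sectional_curvature_def
  by (auto simp: primal.torsion_free dual.torsion_free primal.curvature_eq dual.curvature_eq
    metric_inner_h[simplified] scaleR_diff_right)

section \<open>Dual coordinates and the Pythagorean relation\<close>

lemma chart_primal: "primal.chart x = x"
  unfolding primal.chart_def primal.\<eta>_def by (simp add: E_def)

lemma chart_dual: "dual.chart x = dual_coord \<alpha> \<phi> x"
  by (simp add: dual.chart_def dual.\<eta>_def F_def F\<^sub>0_eq dual_coord_def vec_eq_iff)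

abbreviation \<eta> :: "real^'n \<Rightarrow> real^'n" where
  "\<eta> \<equiv> dual_coord \<alpha> \<phi>"

text \<open>\<open>N x y\<close> is affine in \<open>x\<close>; dividing by its value at
  \<open>x = 0\<close> leaves a function of \<open>x\<close> and \<open>\<eta> y\<close>
  alone.\<close>

lemma N_eq_\<eta>: "y \<in> \<Omega> \<Longrightarrow> N x y = (1 - \<alpha> * (grad \<phi> y \<bullet> y)) * (1 + \<alpha> * (\<eta> y \<bullet> x))"
  using W_pos[of y] by (simp add: N_def dual_coord_def inner_diff_right field_simps)

lemma one_plus_\<eta>: "y \<in> \<Omega> \<Longrightarrow> (1 - \<alpha> * (grad \<phi> y \<bullet> y)) * (1 + \<alpha> * (\<eta> y \<bullet> y)) = 1"
  using N_eq_\<eta>[of y y] by simp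

text \<open>If \<open>x\<close> and \<open>y\<close> have the same dual coordinate then \<open>N x y * N y x = 1\<close>, which contradicts
  the strict inequality between \<open>N x y\<close> and \<open>exp (\<alpha> * (\<phi> x - \<phi> y))\<close> for \<open>x \<noteq> y\<close>.\<close>

lemma inj_on_\<eta>: "inj_on \<eta> \<Omega>"
proof (rule inj_onI, rule ccontr)
  fix x y assume x: "x \<in> \<Omega>" and y: "y \<in> \<Omega>" and eq: "\<eta> x = \<eta> y" and ne: "x \<noteq> y"
  define e where "e = exp (\<alpha> * (\<phi> x - \<phi> y))"
  have e: "0 < e" by (simp add: e_def)
  have inv: "exp (\<alpha> * (\<phi> y - \<phi> x)) = 1 / e"
    by (simp add: e_def exp_minus[symmetric] divide_inverse algebra_simps)
  \<comment> \<open>Equal dual coordinates may be exchanged, which regroups the factors into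
    \<open>N x x * N y y\<close>.\<close>
  have "N x y * N y x = ((1 - \<alpha> * (grad \<phi> x \<bullet> x)) * (1 + \<alpha> * (\<eta> x \<bullet> x))) *
      ((1 - \<alpha> * (grad \<phi> y \<bullet> y)) * (1 + \<alpha> * (\<eta> y \<bullet> y)))"
    by (simp only: N_eq_\<eta> x y eq mult_ac)
  also have "\<dots> = 1" by (simp only: one_plus_\<eta> x y mult_1)
  finally have Nyx: "N y x = 1 / N x y" and N: "0 < N x y"
    using N_pos'[OF x y] by (auto simp: field_simps)
  have lt: "s * (e - N x y) < 0" "s * (1 / e - 1 / N x y) < 0"
    using exp_less_tangent[OF x y ne] exp_less_tangent[OF y x] ne by (auto simp: e_def[symmetric] inv Nyx)
  \<comment> \<open>Reciprocals of positive numbers reverse the order, so the two inequalities in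
    \<open>lt\<close> exclude each other for either sign.\<close>
  have "s * (1 / e - 1 / N x y) = - (s * (e - N x y)) / (e * N x y)"
    using e N by (simp add: field_simps)
  moreover have "0 < - (s * (e - N x y)) / (e * N x y)"
    using lt(1) e N by (intro divide_pos_pos mult_pos_pos) auto
  ultimately show False using lt(2) by simp
qed

text \<open>The primal chart is the identity, so convexity of \<Omega> provides the segment; for the
  dual chart it is assumed, and injectivity is \<open>inj_on_\<eta>\<close>.\<close>

lemma geodesics_exist:
  assumes "q \<in> \<Omega>" "r \<in> \<Omega>"
  shows "\<exists>c. geodesic_from_to \<Omega> (primal_connection D) q r c"
    and "p \<in> \<Omega> \<Longrightarrow> closed_segment (\<eta> q) (\<eta> p) \<subseteq> \<eta> ` \<Omega> \<Longrightarrow>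
      \<exists>c. geodesic_from_to \<Omega> (dual_connection D) q p c"
  using assms closed_segment_subset[OF assms \<Omega>(2)]
  by (auto intro!: primal.geodesic_exists dual.geodesic_exists simp: chart_primal chart_dual
    inj_on_\<eta> inj_on_def[of primal.chart] cong: inj_on_cong image_cong)

text \<open>The \<phi> terms telescope, leaving \<open>N q p * N r q = N r p\<close>. The condition
  on the right is linear in \<open>r - q\<close> and in \<open>\<eta> p - \<eta> q\<close>
  separately, so displacements can be replaced by multiples of vectors at \<open>q\<close>.\<close>

lemma Pythagoras_iff:
  assumes "p \<in> \<Omega>" "q \<in> \<Omega>" "r \<in> \<Omega>"
  shows "D q p + D r q = D r p \<longleftrightarrow>
    (1 + \<alpha> * (\<eta> q \<bullet> q)) * ((r - q) \<bullet> (\<eta> p - \<eta> q)) = \<alpha> * ((\<eta> p - \<eta> q) \<bullet> q) * (\<eta> q \<bullet> (r - q))"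
proof -
  define \<omega> where "\<omega> = 1 + \<alpha> * (\<eta> q \<bullet> q)"
  define wp where "wp = 1 - \<alpha> * (grad \<phi> p \<bullet> p)"
  define wq where "wq = 1 - \<alpha> * (grad \<phi> q \<bullet> q)"
  have w: "0 < wp" "0 < wq" "wq * \<omega> = 1"
    using W_pos assms one_plus_\<eta>[OF assms(2)] by (auto simp: wp_def wq_def \<omega>_def)
  have "D q p + D r q = D r p \<longleftrightarrow> s / \<alpha> * (ln (N q p) + ln (N r q) - ln (N r p)) = 0"
    by (simp add: D_def algebra_simps add_divide_distrib diff_divide_distrib)
  also have "\<dots> \<longleftrightarrow> ln (N q p * N r q) = ln (N r p)"
    using \<alpha> s_ne N_ne assms by (simp add: ln_mult)
  also have "\<dots> \<longleftrightarrow> N q p * N r q = N r p"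
    using N_pos' assms by (intro ln_inj_iff mult_pos_pos) auto
  also have "\<dots> \<longleftrightarrow> wp * ((1 + \<alpha> * (\<eta> p \<bullet> q)) * (wq * (1 + \<alpha> * (\<eta> q \<bullet> r)))) = wp * (1 + \<alpha> * (\<eta> p \<bullet> r))"
    by (simp add: N_eq_\<eta> assms wp_def wq_def mult_ac)
  \<comment> \<open>After cancelling \<open>wp\<close>, the factor \<open>wq * \<omega> = 1\<close>
    on the right makes \<open>wq\<close> common to both sides.\<close>
  also have "\<dots> \<longleftrightarrow> wq * ((1 + \<alpha> * (\<eta> p \<bullet> q)) * (1 + \<alpha> * (\<eta> q \<bullet> r))) = wq * (\<omega> * (1 + \<alpha> * (\<eta> p \<bullet> r)))"
    using w by (simp add: mult.assoc[symmetric]) (simp add: mult_ac)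
  also have "\<dots> \<longleftrightarrow> (1 + \<alpha> * (\<eta> p \<bullet> q)) * (1 + \<alpha> * (\<eta> q \<bullet> r)) = \<omega> * (1 + \<alpha> * (\<eta> p \<bullet> r))"
    using w by simp
  also have "\<dots> \<longleftrightarrow> \<alpha> * (\<omega> * ((r - q) \<bullet> (\<eta> p - \<eta> q)) - \<alpha> * ((\<eta> p - \<eta> q) \<bullet> q) * (\<eta> q \<bullet> (r - q))) = 0"
    by (simp add: \<omega>_def inner_diff_left inner_diff_right inner_commute[of r] inner_commute[of q] algebra_simps)
      (rule eq_commute)
  finally show ?thesis
    using \<alpha> by (simp add: \<omega>_def)
qed

lemma Pythagorean_theorem:
  assumes p: "p \<in> \<Omega>" and q: "q \<in> \<Omega>" and r: "r \<in> \<Omega>"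
    and c: "geodesic_from_to \<Omega> (primal_connection D) q r c"
    and c': "geodesic_from_to \<Omega> (dual_connection D) q p c'"
  shows "D q p + D r q = D r p \<longleftrightarrow>
    metric_inner (div_metric D) q (velocity c 0) (velocity c' 0) = 0"
proof -
  \<comment> \<open>Up to the factor \<open>- s\<close>, the covector that the metric assigns to the
    dual velocity; orthogonality means \<open>velocity c 0 \<bullet> z = 0\<close>.\<close>
  define z where "z = M q *v velocity c' 0"
  define \<omega> where "\<omega> = 1 + \<alpha> * (\<eta> q \<bullet> q)"
  obtain m where m: "0 < m" "\<And>k. primal.\<eta> k r - primal.\<eta> k q = m * (grad (primal.\<eta> k) q \<bullet> velocity c 0)"
    using primal.geodesic_displacement[OF c] by blast
  have "primal.\<eta> k = (\<lambda>x. x $ k)" for k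
    unfolding primal.\<eta>_def[abs_def] by (simp add: E_def)
  then have rq: "r - q = m *\<^sub>R velocity c 0"
    using m(2) by (simp add: vec_eq_iff grad_sum_axis if_distrib[where f = "\<lambda>c. _ * c"] cong: if_cong)
  obtain m' where m': "0 < m'" "\<And>k. dual.\<eta> k p - dual.\<eta> k q = m' * (grad (dual.\<eta> k) q \<bullet> velocity c' 0)"
    using dual.geodesic_displacement[OF c'] by blast
  have \<eta>k: "dual.\<eta> k x = \<eta> x $ k" for k x
    using chart_dual[of x] by (metis dual.chart_def vec_lambda_beta)
  have w: "(1 - \<alpha> * (grad \<phi> q \<bullet> q)) * \<omega> = 1" "0 < 1 - \<alpha> * (grad \<phi> q \<bullet> q)"
    using one_plus_\<eta>[OF q] W_pos[OF q] by (auto simp: \<omega>_def)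
  then have \<omega>: "0 < \<omega>"
    by (metis less_numeral_extra(1) zero_less_mult_pos)
  have "grad (dual.\<eta> k) q \<bullet> velocity c' 0 = \<omega> * (z $ k + \<alpha> * (z \<bullet> q) * \<eta> q $ k)" for k
  proof -
    \<comment> \<open>The quotient rule for \<open>F k\<close> over \<open>F\<^sub>0\<close>,
      cleared of denominators.\<close>
    have "F\<^sub>0 q * (grad (dual.\<eta> k) q \<bullet> velocity c' 0) =
      grad (F k) q \<bullet> velocity c' 0 - \<eta> q $ k * (grad F\<^sub>0 q \<bullet> velocity c' 0)"
      by (simp add: dual.grad_f[OF q] inner_add_left \<eta>k)
    also have "grad F\<^sub>0 q \<bullet> velocity c' 0 = - \<alpha> * exp (\<alpha> * \<phi> q) * (z \<bullet> q)"
      by (simp add: grad_F\<^sub>0[OF q] grad_F[OF q] z_def inner_vec_def[of _ q] sum_distrib_left mult_ac)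
    also have "grad (F k) q \<bullet> velocity c' 0 = exp (\<alpha> * \<phi> q) * z $ k"
      by (simp add: grad_F[OF q] z_def)
    finally have "exp (\<alpha> * \<phi> q) * ((1 - \<alpha> * (grad \<phi> q \<bullet> q)) * (grad (dual.\<eta> k) q \<bullet> velocity c' 0)) =
       exp (\<alpha> * \<phi> q) * (z $ k + \<alpha> * (z \<bullet> q) * \<eta> q $ k)"
      by (simp add: F\<^sub>0_eq[of q] algebra_simps)
    then have "(1 - \<alpha> * (grad \<phi> q \<bullet> q)) * (grad (dual.\<eta> k) q \<bullet> velocity c' 0) =
       z $ k + \<alpha> * (z \<bullet> q) * \<eta> q $ k" by simp
    then show ?thesis using w(1) by (metis mult.commute mult.left_commute mult.right_neutral)
  qed
  then have \<Delta>: "\<eta> p - \<eta> q = (m' * \<omega>) *\<^sub>R (z + (\<alpha> * (z \<bullet> q)) *\<^sub>R \<eta> q)"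
    using m'(2) by (simp add: vec_eq_iff \<eta>k algebra_simps)
  have "D q p + D r q = D r p \<longleftrightarrow>
    \<omega> * ((r - q) \<bullet> (\<eta> p - \<eta> q)) - \<alpha> * ((\<eta> p - \<eta> q) \<bullet> q) * (\<eta> q \<bullet> (r - q)) = 0"
    using Pythagoras_iff[OF p q r] by (simp add: \<omega>_def)
  also have "(\<eta> p - \<eta> q) \<bullet> q = m' * \<omega> * \<omega> * (z \<bullet> q)"
    by (simp add: \<Delta> \<omega>_def inner_add_left algebra_simps)
  \<comment> \<open>The part of the dual displacement along \<open>\<eta> q\<close> cancels against
    the second term; only the pairing with \<open>z\<close> survives.\<close>
  also have "\<omega> * ((r - q) \<bullet> (\<eta> p - \<eta> q)) - \<alpha> * (m' * \<omega> * \<omega> * (z \<bullet> q)) * (\<eta> q \<bullet> (r - q)) =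
    m' * \<omega> * \<omega> * ((r - q) \<bullet> z)"
    by (simp add: \<Delta> inner_add_right inner_commute[of _ "\<eta> q"] algebra_simps)
  also have "(r - q) \<bullet> z = m * (velocity c 0 \<bullet> z)"
    by (simp add: rq)
  also have "m' * \<omega> * \<omega> * (m * (velocity c 0 \<bullet> z)) = 0 \<longleftrightarrow>
    metric_inner (div_metric D) q (velocity c 0) (velocity c' 0) = 0"
    using m m' \<omega> s_ne by (simp add: metric_inner_D[OF q] z_def)
  finally show ?thesis .
qed

end

theorem theorem2:
  fixes \<alpha> \<kappa> :: real and \<Omega> :: "(real^'n::finite) set" and \<phi> :: "real^'n \<Rightarrow> real"
    and D :: "'n divergence"
  assumes "0 < \<alpha>" and "2 \<le> CARD('n)" and "open \<Omega>" and "convex \<Omega>"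
    and "(D = L_plus_divergence \<alpha> \<phi> \<and> exp_concave_on \<alpha> \<Omega> \<phi> \<and> conditions_A \<alpha> \<Omega> \<phi> \<and> \<kappa> = - \<alpha>) \<or>
         (D = L_minus_divergence \<alpha> \<phi> \<and> exp_convex_on \<alpha> \<Omega> \<phi> \<and> conditions_B \<alpha> \<Omega> \<phi> \<and> \<kappa> = \<alpha>)"
  shows
    "(projectively_flat \<Omega> (primal_connection D) \<and> projectively_flat \<Omega> (dual_connection D)) \<and>
     (constant_sectional_curvature \<Omega> (div_metric D) (primal_connection D) \<kappa> \<and>
      constant_sectional_curvature \<Omega> (div_metric D) (dual_connection D) \<kappa>) \<and>
     (\<forall>p\<in>\<Omega>. \<forall>q\<in>\<Omega>. \<forall>r\<in>\<Omega>.
        closed_segment (dual_coord \<alpha> \<phi> q) (dual_coord \<alpha> \<phi> p) \<subseteq> dual_coord \<alpha> \<phi> ` \<Omega> \<longrightarrow>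
        (\<exists>c. geodesic_from_to \<Omega> (primal_connection D) q r c) \<and>
        (\<exists>c'. geodesic_from_to \<Omega> (dual_connection D) q p c') \<and>
        (\<forall>c c'. geodesic_from_to \<Omega> (primal_connection D) q r c \<longrightarrow>
           geodesic_from_to \<Omega> (dual_connection D) q p c' \<longrightarrow>
           (D q p + D r q = D r p \<longleftrightarrow>
            metric_inner (div_metric D) q (velocity c 0) (velocity c' 0) = 0)))"
proof -
  obtain s where "L_divergence \<alpha> s \<Omega> \<phi>" and D: "D = L_divergence.D \<alpha> s \<phi>" and \<kappa>: "\<kappa> = - s * \<alpha>"
    using assms(5)
  proof
    assume A: "D = L_plus_divergence \<alpha> \<phi> \<and> exp_concave_on \<alpha> \<Omega> \<phi> \<and> conditions_A \<alpha> \<Omega> \<phi> \<and> \<kappa> = - \<alpha>"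
    interpret exp_concave_or_convex \<alpha> 1 \<Omega> \<phi>
      using A assms(1-4) by unfold_locales (auto simp: conditions_A_def)
    \<comment> \<open>For \<open>s = 1\<close> the exponential lies strictly below the tangent
      plane, which forces \<open>N\<close> to be positive; at \<open>x = y\<close> it is 1.\<close>
    have "0 < N x y" if "x \<in> \<Omega>" "y \<in> \<Omega>" for x y
      using exp_less_tangent[OF that] less_trans[OF exp_gt_zero[of "\<alpha> * (\<phi> x - \<phi> y)"], of "N x y"]
      by (cases "x = y") (auto simp: N_def)
    then interpret L_divergence \<alpha> 1 \<Omega> \<phi>
      using A by unfold_locales (auto simp: conditions_A_def N_def)
    show thesis
      by (rule that[of 1]) (use A L_divergence_axioms in
        \<open>auto simp: D_def N_def L_plus_divergence_def fun_eq_iff\<close>)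
  next
    assume B: "D = L_minus_divergence \<alpha> \<phi> \<and> exp_convex_on \<alpha> \<Omega> \<phi> \<and> conditions_B \<alpha> \<Omega> \<phi> \<and> \<kappa> = \<alpha>"
    then have pos: "0 < 1 + \<alpha> * (grad \<phi> y \<bullet> (x - y))" if "x \<in> \<Omega>" "y \<in> \<Omega>" for x y
      using that by (simp add: conditions_B_def)
    \<comment> \<open>Since 0 lies in \<Omega>, \<open>pos[of 0]\<close> is the condition
      \<open>W_pos\<close>.\<close>
    interpret L_divergence \<alpha> "-1" \<Omega> \<phi>
      using B assms(1-4) pos pos[of 0] by unfold_locales (auto simp: conditions_B_def)
    show thesis
      by (rule that[of "-1"]) (use B L_divergence_axioms in
        \<open>auto simp: D_def N_def L_minus_divergence_def fun_eq_iff\<close>)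
  qed
  then interpret L_divergence \<alpha> s \<Omega> \<phi> by simp
  show ?thesis
    unfolding D \<kappa>
    using primal.projectively_flat dual.projectively_flat constant_sectional_curvature
      geodesics_exist Pythagorean_theorem by blast
qed

end
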